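(* Fix the constants $\eta=0.02$, $\beta_l=0.9$, $\beta_u=0.905$, $\omega=0.005$, $\alpha_c=0.85$, $\sigma=0.9025$. Let $\delta=\eta^2+2\eta$, $\gamma=\sqrt{\frac{(\eta+\sqrt{\nu})^2}{1-\delta}+\frac{\beta_u}{2}}$ and $\alpha_p=\frac{\omega\sqrt{1-\delta}}{\gamma}$. Let $z\in\mathcal N(\eta,\beta_l,\beta_u)$, let $z^+=z+\alpha_p\Delta z_p$ be the predictor point and $z^{++}=z^++\alpha_c\Delta z_c$ the corrected point, where $\Delta z_p$ and $\Delta z_c$ are the predictor and corrector directions defined in the context. Then: (i) $z^+\in\mathcal N(0.03518,\,0.89995,\,0.90503)$; (ii) $z^{++}\in\mathcal N(0.01665,\,0.90028,\,0.90376)$. Consequently, $z^{++}\in\mathcal N(\eta,\beta_l,\beta_u)$.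
   Context: $\mathbb K\subseteq\mathbb R^n$ ($n\ge1$) is a proper cone (closed, convex, pointed, nonempty interior; in general not symmetric) with dual cone $\mathbb K^*=\{s:\langle s,x\rangle\ge0\ \forall x\in\mathbb K\}$; $A\in\mathbb R^{m\times n}$ has full row rank, $b\in\mathbb R^m$, $c\in\mathbb R^n$. $F:\operatorname{int}(\mathbb K)\to\mathbb R$ is a $\nu$-logarithmically homogeneous self-concordant barrier ($\nu$-LHSCB): $F$ is convex, $C^3$, satisfies $|D^3F(x)[h,h,h]|\le2(D^2F(x)[h,h])^{3/2}$, tends to $+\infty$ along every sequence in $\operatorname{int}(\mathbb K)$ converging to a boundary point, and $F(tx)=F(x)-\nu\log t$ for $t>0$. It is a known fact that $\nu\ge1$ and $\nabla^2F(x)\succ0$. Write $g_x=\nabla F(x)$, $H_x=\nabla^2F(x)$, $\|v\|_x^*=\langle v,H_x^{-1}v\rangle^{1/2}$. Points are $z=(\bar x;y;\bar s)$ with $\bar x=(x;\tau)\in\mathbb K\times\mathbb R_+$, $y\in\mathbb R^m$, $\bar s=(s;\kappa)\in\mathbb K^*\times\mathbb R_+$; $\mathcal F=(\mathbb K\times\mathbb R_+)\times\mathbb R^m\times(\mathbb K^*\times\mathbb R_+)$; $\mu=\langle x,s\rangle/\nu$; $\psi(x,s,\mu)=s+\mu g_x$; $$\mathcal N(\eta,\beta_l,\beta_u)=\{z\in\operatorname{int}(\mathcal F):\ \|\psi(x,s,\mu)\|_x^*\le\eta\mu,\ \beta_l\mu\le\kappa\tau\le\beta_u\mu\},$$ $$G=\begin{pmatrix}0&A&-b\\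 -A^\top&0&c\\ b^\top&-c^\top&0\end{pmatrix},\qquad r(z)=G(y;\bar x)-(0;\bar s).$$ Predictor direction at $z$: with $W=H_x+\frac{ss^\top}{\nu\mu^2}-\frac{g_xg_x^\top}{\nu}$, $\Delta z_p=(\Delta\bar x_p;\Delta y_p;\Delta\bar s_p)$, $\Delta\bar x_p=(\Delta x_p;\Delta\tau_p)$, $\Delta\bar s_p=(\Delta s_p;\Delta\kappa_p)$, is the solution of $$G(\Delta y_p;\Delta\bar x_p)-(0;\Delta\bar s_p)=-r(z),\quad \tau\Delta\kappa_p+\kappa\Delta\tau_p=-\kappa\tau,\quad \Delta s_p+\mu W\Delta x_p=-s.$$ Corrector direction at $z^+$: with $\mu^+=\langle x^+,s^+\rangle/\nu$ and $W^+=H_{x^+}+\frac{s^+(s^+)^\top}{\nu(\mu^+)^2}-\frac{g_{x^+}g_{x^+}^\top}{\nu}$, $\Delta z_c=(\Delta\bar x_c;\Delta y_c;\Delta\bar s_c)$, $\Delta\bar x_c=(\Delta x_c;\Delta\tau_c)$, $\Delta\bar s_c=(\Delta s_c;\Delta\kappa_c)$, is the solution of $$G(\Delta y_c;\Delta\bar x_c)-(0;\Delta\bar s_c)=0,\quad \tau^+\Delta\kappa_c+\kappa^+\Delta\tau_c=\sigma\mu^+-\kappa^+\tau^+,\quad \Delta s_c+\mu^+W^+\Delta x_c=-\psi(x^+,s^+,\mu^+).$$ *)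

theory Defs
  imports "HOL-Analysis.Analysis"
begin

definition proper_cone :: "(real^'n) set \<Rightarrow> bool" where
  "proper_cone K \<longleftrightarrow> closed K \<and> convex K \<and> cone K \<and> K \<inter> uminus ` K = {0} \<and> interior K \<noteq> {}"

definition dual_cone :: "(real^'n) set \<Rightarrow> (real^'n) set" where
  "dual_cone K = {s. \<forall>x\<in>K. 0 \<le> s \<bullet> x}"

definition dir_deriv :: "(real^'n \<Rightarrow> real) \<Rightarrow> real^'n \<Rightarrow> real^'n \<Rightarrow> real" where
  "dir_deriv f h x = frechet_derivative f (at x) h"

text \<open>\<open>C\<^sup>k\<close> on an open set \<open>S\<close>, through iterated directional derivatives.\<close>

primrec C_on :: "nat \<Rightarrow> (real^'n \<Rightarrow> real) \<Rightarrow> (real^'n) set \<Rightarrow> bool" where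
  "C_on 0 f S \<longleftrightarrow> continuous_on S f"
| "C_on (Suc k) f S \<longleftrightarrow> (\<forall>x\<in>S. f differentiable (at x)) \<and> (\<forall>h. C_on k (dir_deriv f h) S)"

definition gradient :: "(real^'n \<Rightarrow> real) \<Rightarrow> real^'n \<Rightarrow> real^'n" where
  "gradient f x = (\<chi> i. dir_deriv f (axis i 1) x)"

definition hessian :: "(real^'n \<Rightarrow> real) \<Rightarrow> real^'n \<Rightarrow> real^'n^'n" where
  "hessian f x = (\<chi> i j. dir_deriv (dir_deriv f (axis j 1)) (axis i 1) x)"

text \<open>\<open>F\<close> is total, but only its values on the open set \<open>interior K\<close> matter.\<close>

definition lhscb :: "(real^'n) set \<Rightarrow> real \<Rightarrow> (real^'n \<Rightarrow> real) \<Rightarrow> bool" where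
  "lhscb K \<nu> F \<longleftrightarrow>
     convex_on (interior K) F \<and>
     C_on 3 F (interior K) \<and>
     (\<forall>x\<in>interior K. \<forall>h.
        \<bar>dir_deriv (dir_deriv (dir_deriv F h) h) h x\<bar> \<le> 2 * (dir_deriv (dir_deriv F h) h x) powr (3/2)) \<and>
     (\<forall>u x. (\<forall>k. u k \<in> interior K) \<and> u \<longlonglongrightarrow> x \<and> x \<in> frontier K
        \<longrightarrow> filterlim (\<lambda>k. F (u k)) at_top sequentially) \<and>
     (\<forall>x\<in>interior K. \<forall>t>0. F (t *\<^sub>R x) = F x - \<nu> * ln t)"

definition dual_local_norm :: "(real^'n \<Rightarrow> real) \<Rightarrow> real^'n \<Rightarrow> real^'n \<Rightarrow> real" where
  "dual_local_norm F x v = sqrt (v \<bullet> (matrix_inv (hessian F x) *v v))"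

text \<open>A point \<open>((x, \<tau>), y, (s, \<kappa>))\<close>.\<close>

type_synonym ('n, 'm) point = "((real^'n) \<times> real) \<times> (real^'m) \<times> ((real^'n) \<times> real)"

definition feasible :: "(real^'n) set \<Rightarrow> ('n, 'm::finite) point set" where
  "feasible K = (K \<times> {0..}) \<times> UNIV \<times> (dual_cone K \<times> {0..})"

definition compl_gap :: "real \<Rightarrow> real^'n \<Rightarrow> real^'n \<Rightarrow> real" where
  "compl_gap \<nu> x s = (x \<bullet> s) / \<nu>"

definition psi :: "(real^'n \<Rightarrow> real) \<Rightarrow> real^'n \<Rightarrow> real^'n \<Rightarrow> real \<Rightarrow> real^'n" where
  "psi F x s \<mu> = s + \<mu> *\<^sub>R gradient F x"

definition nbhd :: "(real^'n) set \<Rightarrow> (real^'n \<Rightarrow> real) \<Rightarrow> real \<Rightarrow> real \<Rightarrow> real \<Rightarrow> real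
    \<Rightarrow> ('n, 'm::finite) point set" where
  "nbhd K F \<nu> \<eta> \<beta>\<^sub>l \<beta>\<^sub>u = {((x, \<tau>), y, (s, \<kappa>)) | x \<tau> y s \<kappa>.
     ((x, \<tau>), y, (s, \<kappa>)) \<in> interior (feasible K) \<and>
     dual_local_norm F x (psi F x s (compl_gap \<nu> x s)) \<le> \<eta> * compl_gap \<nu> x s \<and>
     \<beta>\<^sub>l * compl_gap \<nu> x s \<le> \<kappa> * \<tau> \<and> \<kappa> * \<tau> \<le> \<beta>\<^sub>u * compl_gap \<nu> x s}"

text \<open>The action of the skew-symmetric block matrix with rows
  \<open>(0, A, -b)\<close>, \<open>(-A\<^sup>T, 0, c)\<close>, \<open>(b\<^sup>T, -c\<^sup>T, 0)\<close> on \<open>(y, (x, \<tau>))\<close>.\<close>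

definition G_map :: "real^'n^'m \<Rightarrow> real^'m \<Rightarrow> real^'n \<Rightarrow> (real^'m) \<times> ((real^'n) \<times> real)
    \<Rightarrow> (real^'m) \<times> ((real^'n) \<times> real)" where
  "G_map A b c = (\<lambda>(y, (x, \<tau>)).
     (A *v x - \<tau> *\<^sub>R b, (- (transpose A *v y) + \<tau> *\<^sub>R c, b \<bullet> y - c \<bullet> x)))"

definition residual :: "real^'n^'m \<Rightarrow> real^'m \<Rightarrow> real^'n \<Rightarrow> ('n, 'm) point
    \<Rightarrow> (real^'m) \<times> ((real^'n) \<times> real)" where
  "residual A b c = (\<lambda>(xbar, y, sbar). G_map A b c (y, xbar) - (0, sbar))"

definition outer :: "real^'n \<Rightarrow> real^'n^'n" where
  "outer v = (\<chi> i j. v $ i * v $ j)"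

definition scaling :: "(real^'n \<Rightarrow> real) \<Rightarrow> real \<Rightarrow> real^'n \<Rightarrow> real^'n \<Rightarrow> real^'n^'n" where
  "scaling F \<nu> x s = hessian F x + (1 / (\<nu> * (compl_gap \<nu> x s)\<^sup>2)) *\<^sub>R outer s
     - (1 / \<nu>) *\<^sub>R outer (gradient F x)"

definition predictor_system :: "(real^'n \<Rightarrow> real) \<Rightarrow> real \<Rightarrow> real^'n^'m \<Rightarrow> real^'m \<Rightarrow> real^'n
    \<Rightarrow> ('n, 'm) point \<Rightarrow> ('n, 'm) point \<Rightarrow> bool" where
  "predictor_system F \<nu> A b c = (\<lambda>((x, \<tau>), y, (s, \<kappa>)) ((dx, d\<tau>), dy, (ds, d\<kappa>)).
     G_map A b c (dy, (dx, d\<tau>)) - (0, (ds, d\<kappa>)) = - residual A b c ((x, \<tau>), y, (s, \<kappa>)) \<and>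
     \<tau> * d\<kappa> + \<kappa> * d\<tau> = - (\<kappa> * \<tau>) \<and>
     ds + compl_gap \<nu> x s *\<^sub>R (scaling F \<nu> x s *v dx) = - s)"

definition corrector_system :: "(real^'n \<Rightarrow> real) \<Rightarrow> real \<Rightarrow> real^'n^'m \<Rightarrow> real^'m \<Rightarrow> real^'n
    \<Rightarrow> real \<Rightarrow> ('n, 'm) point \<Rightarrow> ('n, 'm) point \<Rightarrow> bool" where
  "corrector_system F \<nu> A b c \<sigma> = (\<lambda>((x, \<tau>), y, (s, \<kappa>)) ((dx, d\<tau>), dy, (ds, d\<kappa>)).
     G_map A b c (dy, (dx, d\<tau>)) - (0, (ds, d\<kappa>)) = 0 \<and>
     \<tau> * d\<kappa> + \<kappa> * d\<tau> = \<sigma> * compl_gap \<nu> x s - \<kappa> * \<tau> \<and>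
     ds + compl_gap \<nu> x s *\<^sub>R (scaling F \<nu> x s *v dx) = - psi F x s (compl_gap \<nu> x s))"

text \<open>\<open>THE\<close> denotes the solution only where it exists and is unique; a theorem about the two
  directions below therefore has to establish unique solvability.\<close>

definition predictor_direction :: "(real^'n \<Rightarrow> real) \<Rightarrow> real \<Rightarrow> real^'n^'m \<Rightarrow> real^'m \<Rightarrow> real^'n
    \<Rightarrow> ('n, 'm) point \<Rightarrow> ('n, 'm) point" where
  "predictor_direction F \<nu> A b c z = (THE dz. predictor_system F \<nu> A b c z dz)"

definition corrector_direction :: "(real^'n \<Rightarrow> real) \<Rightarrow> real \<Rightarrow> real^'n^'m \<Rightarrow> real^'m \<Rightarrow> real^'n
    \<Rightarrow> real \<Rightarrow> ('n, 'm) point \<Rightarrow> ('n, 'm) point" where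
  "corrector_direction F \<nu> A b c \<sigma> z = (THE dz. corrector_system F \<nu> A b c \<sigma> z dz)"

end

theory Submission
  imports Defs
begin

text \<open>
  In the local norm of \<open>x\<close> the scaling matrix \<open>W\<close> differs from the Hessian \<open>H\<close> by at most
  \<open>\<eta>\<^sup>2 + 2 \<eta>\<close>, and \<open>\<mu> W x = s\<close>. Skew-symmetry of \<open>G\<close> turns each Newton system into one
  scalar identity, which bounds the step in the local norm and gives the exact values of \<open>\<mu>\<close> and
  \<open>\<kappa> \<tau>\<close> after the step: up to a second-order term, the predictor scales both by
  \<open>1 - \<alpha>\<close>, while the corrector keeps \<open>\<mu>\<close> and moves \<open>\<kappa> \<tau>\<close> towards \<open>\<sigma> \<mu>\<close>. The new
  proximity vector is a multiple of the old one plus the errors of replacing \<open>W\<close> by \<open>H\<close> and of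
  linearising the gradient of \<open>F\<close>. The constants of the theorem are generous enough that a
  third-derivative bound obtained by plain polarisation suffices for the latter.
\<close>

section \<open>Directional derivatives\<close>

text \<open>Positive definiteness of the Hessian and \<nu> >= 1 are derived from the barrier axioms,
  which bound the third derivative only on the diagonal. The obstacle is circularity: the classical
  Dikin argument divides by the local norm of the direction, which may vanish while definiteness is
  open. A positive shift of the second derivative removes the division by zero, so the Dikin
  ellipsoid comes first and definiteness follows from it.

  All estimates are uniform in \<nu>: the step length offsets the size of the predictor, and each
  factor sqrt \<nu> contributed by the gradient meets a division by \<nu>. The scaled steps have
  local length at most 0.005 (predictor) and 0.85 * 0.0382 (corrector), both below 1/25. On that
  range the cubic constant 4 yields the factor 6/5 between Hessians, 11/10 between norms and 5 a^2
  for the linearisation error. Interiority of \<open>s\<close> is not tracked along a step, since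
  small proximity forces it; \<tau> and \<kappa> need a sign argument, since a positive product
  leaves their common sign open.\<close>

lemma has_derivative_dir_deriv:
  assumes "f differentiable (at x)"
  shows "(f has_derivative (\<lambda>h. dir_deriv f h x)) (at x)"
  using assms unfolding dir_deriv_def by (simp add: frechet_derivative_works)

lemma linear_dir_deriv:
  assumes "f differentiable (at x)"
  shows "linear (\<lambda>h. dir_deriv f h x)"
  using has_derivative_dir_deriv[OF assms] has_derivative_linear by blast

lemma dir_deriv_eqI:
  assumes "(f has_derivative f') (at x)"
  shows "dir_deriv f h x = f' h"
  using frechet_derivative_at[OF assms] unfolding dir_deriv_def by simp

lemma dir_deriv_cong_open:
  assumes "open S" "x \<in> S" "\<And>y. y \<in> S \<Longrightarrow> f y = g y" "f differentiable (at x)"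
  shows "dir_deriv f h x = dir_deriv g h x"
proof -
  have "(g has_derivative (\<lambda>h. dir_deriv f h x)) (at x)"
    by (rule has_derivative_transform_within_open[OF has_derivative_dir_deriv[OF assms(4)] assms(1,2,3)])
  from dir_deriv_eqI[OF this] show ?thesis by simp
qed

lemma has_real_derivative_along_line:
  assumes "(f has_derivative f') (at (x + t *\<^sub>R u))"
  shows "((\<lambda>t. f (x + t *\<^sub>R u)) has_real_derivative f' u) (at t)"
proof -
  have "((\<lambda>t. f (x + t *\<^sub>R u)) has_derivative (\<lambda>s. f' (s *\<^sub>R u))) (at t)"
    by (rule has_derivative_compose[where f = "\<lambda>t. x + t *\<^sub>R u"])
       (auto intro!: derivative_eq_intros assms)
  moreover have "f' (s *\<^sub>R u) = s * f' u" for s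
    using has_derivative_linear[OF assms] by (simp add: linear_cmul)
  ultimately show ?thesis
    by (simp add: has_field_derivative_def mult_commute_abs)
qed

section \<open>Symmetry of second derivatives\<close>

lemma second_difference_mean_value:
  fixes f :: "real^'n \<Rightarrow> real"
  assumes C2: "C_on 2 f S" and s: "s > 0"
    and S: "\<And>a b. 0 \<le> a \<Longrightarrow> a \<le> s \<Longrightarrow> 0 \<le> b \<Longrightarrow> b \<le> s \<Longrightarrow> x + a *\<^sub>R h + b *\<^sub>R k \<in> S"
  obtains a b where "0 < a" "a < s" "0 < b" "b < s"
    "f (x + s *\<^sub>R h + s *\<^sub>R k) - f (x + s *\<^sub>R h) - f (x + s *\<^sub>R k) + f x
       = s * s * dir_deriv (dir_deriv f h) k (x + a *\<^sub>R h + b *\<^sub>R k)"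
proof -
  have diff1: "f differentiable (at y)" if "y \<in> S" for y
    using C2 that by (simp add: numeral_2_eq_2)
  have diff2: "dir_deriv f h differentiable (at y)" if "y \<in> S" for y h
    using C2 that by (simp add: numeral_2_eq_2)
  define \<phi> where "\<phi> = (\<lambda>a. f ((x + s *\<^sub>R k) + a *\<^sub>R h) - f (x + a *\<^sub>R h))"
  have "(\<phi> has_real_derivative (dir_deriv f h ((x + s *\<^sub>R k) + a *\<^sub>R h) - dir_deriv f h (x + a *\<^sub>R h))) (at a)"
    if "0 \<le> a" "a \<le> s" for a
    unfolding \<phi>_def
  proof (rule DERIV_diff)
    have "(x + s *\<^sub>R k) + a *\<^sub>R h \<in> S" using S[of a s] that s by (simp add: algebra_simps)
    from has_real_derivative_along_line[OF has_derivative_dir_deriv[OF diff1[OF this]]]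
    show "((\<lambda>a. f ((x + s *\<^sub>R k) + a *\<^sub>R h)) has_real_derivative dir_deriv f h ((x + s *\<^sub>R k) + a *\<^sub>R h)) (at a)" .
    have "x + a *\<^sub>R h \<in> S" using S[of a 0] that s by simp
    from has_real_derivative_along_line[OF has_derivative_dir_deriv[OF diff1[OF this]]]
    show "((\<lambda>a. f (x + a *\<^sub>R h)) has_real_derivative dir_deriv f h (x + a *\<^sub>R h)) (at a)" .
  qed
  from MVT2[OF s this] obtain a where a: "0 < a" "a < s"
    "\<phi> s - \<phi> 0 = s * (dir_deriv f h ((x + s *\<^sub>R k) + a *\<^sub>R h) - dir_deriv f h (x + a *\<^sub>R h))"
    by auto
  define \<theta> where "\<theta> = (\<lambda>b. dir_deriv f h ((x + a *\<^sub>R h) + b *\<^sub>R k))"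
  have "(\<theta> has_real_derivative dir_deriv (dir_deriv f h) k (x + a *\<^sub>R h + b *\<^sub>R k)) (at b)"
    if "0 \<le> b" "b \<le> s" for b
    unfolding \<theta>_def
    by (rule has_real_derivative_along_line[OF has_derivative_dir_deriv[OF diff2]])
       (use S[of a b] that a in simp)
  from MVT2[OF s this] obtain b where b: "0 < b" "b < s"
    "\<theta> s - \<theta> 0 = s * dir_deriv (dir_deriv f h) k (x + a *\<^sub>R h + b *\<^sub>R k)" by auto
  have "\<phi> s - \<phi> 0 = s * (\<theta> s - \<theta> 0)"
    using a(3) unfolding \<theta>_def by (simp add: algebra_simps)
  then have "\<phi> s - \<phi> 0 = s * s * dir_deriv (dir_deriv f h) k (x + a *\<^sub>R h + b *\<^sub>R k)"
    using b(3) by simp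
  moreover have "\<phi> s - \<phi> 0 = f (x + s *\<^sub>R h + s *\<^sub>R k) - f (x + s *\<^sub>R h) - f (x + s *\<^sub>R k) + f x"
    unfolding \<phi>_def by (simp add: algebra_simps)
  ultimately show ?thesis using that[OF a(1,2) b(1,2)] by simp
qed

text \<open>Schwarz's theorem. The second difference is symmetric in \<open>h\<close> and
  \<open>k\<close>, so the two mixed derivatives agree at two points of an arbitrarily small
  parallelogram, and continuity carries the equality to \<open>x\<close>.\<close>

lemma dir_deriv_commute:
  fixes f :: "real^'n \<Rightarrow> real"
  assumes C2: "C_on 2 f S" and S: "open S" "x \<in> S"
  shows "dir_deriv (dir_deriv f h) k x = dir_deriv (dir_deriv f k) h x"
proof (rule ccontr)
  define D where "D = (\<lambda>h k. dir_deriv (dir_deriv f h) k)"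
  assume "\<not> ?thesis"
  then have ne: "D h k x \<noteq> D k h x" by (simp add: D_def)
  define e where "e = \<bar>D h k x - D k h x\<bar> / 2"
  have e: "e > 0" using ne by (simp add: e_def)
  have cont: "continuous (at x) (D h k)" for h k
    using C2 S by (simp add: numeral_2_eq_2 D_def continuous_on_eq_continuous_at)
  obtain d1 where d1: "d1 > 0" "\<And>y. dist y x < d1 \<Longrightarrow> dist (D h k y) (D h k x) < e"
    using cont[of h k] e unfolding continuous_at_eps_delta by blast
  obtain d2 where d2: "d2 > 0" "\<And>y. dist y x < d2 \<Longrightarrow> dist (D k h y) (D k h x) < e"
    using cont[of k h] e unfolding continuous_at_eps_delta by blast
  obtain d3 where d3: "d3 > 0" "ball x d3 \<subseteq> S"
    using S open_contains_ball by blast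
  define d where "d = min d1 (min d2 d3)"
  have d: "d > 0" using d1 d2 d3 by (simp add: d_def)
  \<comment> \<open>The parallelogram then stays within distance \<open>d\<close> of
    \<open>x\<close>; the summand 1 covers \<open>h = k = 0\<close>.\<close>
  define s where "s = d / (2 * (norm h + norm k + 1))"
  have hk: "norm h + norm k + 1 > 0" by (smt (verit) norm_ge_zero)
  have s: "s > 0" using d hk by (simp add: s_def)
  have close: "dist (x + a *\<^sub>R h + b *\<^sub>R k) x < d" if "0 \<le> a" "a \<le> s" "0 \<le> b" "b \<le> s" for a b
  proof -
    have "dist (x + a *\<^sub>R h + b *\<^sub>R k) x = norm (a *\<^sub>R h + b *\<^sub>R k)" by (simp add: dist_norm algebra_simps)
    also have "\<dots> \<le> a * norm h + b * norm k" using norm_triangle_ineq[of "a *\<^sub>R h" "b *\<^sub>R k"] that by simp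
    also have "\<dots> \<le> s * norm h + s * norm k" using that by (intro add_mono mult_right_mono) auto
    also have "\<dots> < 2 * (s * (norm h + norm k + 1))" using s hk
      by (smt (verit, ccfv_SIG) distrib_left mult_pos_pos norm_ge_zero mult_nonneg_nonneg mult_cancel_left1)
    also have "\<dots> = d" using hk by (simp add: s_def field_simps)
    finally show ?thesis .
  qed
  have inS: "x + a *\<^sub>R h + b *\<^sub>R k \<in> S" if "0 \<le> a" "a \<le> s" "0 \<le> b" "b \<le> s" for a b
  proof -
    have "dist x (x + a *\<^sub>R h + b *\<^sub>R k) < d3" using close[OF that] by (simp add: d_def dist_commute)
    then show ?thesis using d3 by (meson mem_ball subsetD)
  qed
  obtain a b where ab: "0 < a" "a < s" "0 < b" "b < s"
    "f (x + s *\<^sub>R h + s *\<^sub>R k) - f (x + s *\<^sub>R h) - f (x + s *\<^sub>R k) + f x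
       = s * s * D h k (x + a *\<^sub>R h + b *\<^sub>R k)"
    using second_difference_mean_value[OF C2 s inS] unfolding D_def by blast
  have inS': "x + a *\<^sub>R k + b *\<^sub>R h \<in> S" if "0 \<le> a" "a \<le> s" "0 \<le> b" "b \<le> s" for a b
    using inS[of b a] that by (simp add: algebra_simps)
  obtain a' b' where ab': "0 < a'" "a' < s" "0 < b'" "b' < s"
    "f (x + s *\<^sub>R k + s *\<^sub>R h) - f (x + s *\<^sub>R k) - f (x + s *\<^sub>R h) + f x
       = s * s * D k h (x + a' *\<^sub>R k + b' *\<^sub>R h)"
    using second_difference_mean_value[OF C2 s inS'] unfolding D_def by blast
  have "s * s * D h k (x + a *\<^sub>R h + b *\<^sub>R k) = s * s * D k h (x + a' *\<^sub>R k + b' *\<^sub>R h)"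
    using ab(5) ab'(5) by (simp add: algebra_simps)
  then have eq: "D h k (x + a *\<^sub>R h + b *\<^sub>R k) = D k h (x + b' *\<^sub>R h + a' *\<^sub>R k)"
    using s by (simp add: algebra_simps)
  have "dist (D h k (x + a *\<^sub>R h + b *\<^sub>R k)) (D h k x) < e"
    by (rule d1(2)) (use close[of a b] ab d_def in auto)
  moreover have "dist (D k h (x + b' *\<^sub>R h + a' *\<^sub>R k)) (D k h x) < e"
    by (rule d2(2)) (use close[of b' a'] ab' d_def in auto)
  ultimately have "\<bar>D h k x - D k h x\<bar> < 2 * e"
    unfolding dist_real_def eq by linarith
  then show False by (simp add: e_def)
qed

section \<open>Logarithmically homogeneous self-concordant barriers\<close>

locale lhscb_cone =
  fixes K :: "(real^'n) set" and \<nu> :: real and F :: "real^'n \<Rightarrow> real"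
  assumes proper: "proper_cone K" and lhscb: "lhscb K \<nu> F"
begin

abbreviation "g \<equiv> gradient F"
abbreviation "H \<equiv> hessian F"

section \<open>Gradient, Hessian and third derivative as multilinear forms\<close>

definition third :: "real^'n \<Rightarrow> real^'n \<Rightarrow> real^'n \<Rightarrow> real^'n \<Rightarrow> real" where
  "third x l h k = dir_deriv (dir_deriv (dir_deriv F k) h) l x"

lemma C3: "C_on 3 F (interior K)"
  using lhscb by (simp add: lhscb_def)

lemma differentiable_F:
  assumes "x \<in> interior K"
  shows "F differentiable (at x)" "dir_deriv F h differentiable (at x)"
    "dir_deriv (dir_deriv F h) k differentiable (at x)"
  using C3 assms by (simp_all add: numeral_3_eq_3)

lemma dir_deriv_eq_gradient:
  assumes "x \<in> interior K"
  shows "dir_deriv F h x = g x \<bullet> h"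
proof -
  note lin = linear_dir_deriv[OF differentiable_F(1)[OF assms]]
  have "dir_deriv F h x = dir_deriv F (\<Sum>i\<in>UNIV. h $ i *\<^sub>R axis i 1) x"
    using basis_expansion[of h] by (simp add: scalar_mult_eq_scaleR)
  also have "\<dots> = (\<Sum>i\<in>UNIV. h $ i * dir_deriv F (axis i 1) x)"
    by (simp add: linear_sum[OF lin] linear_cmul[OF lin])
  finally show ?thesis by (simp add: gradient_def inner_vec_def mult.commute)
qed

lemma has_derivative_F:
  assumes "x \<in> interior K"
  shows "(F has_derivative (\<lambda>h. g x \<bullet> h)) (at x)"
  using has_derivative_dir_deriv[OF differentiable_F(1)[OF assms]]
  by (simp add: dir_deriv_eq_gradient[OF assms])

lemma has_derivative_inner_gradient:
  assumes "x \<in> interior K"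
  shows "((\<lambda>x. g x \<bullet> k) has_derivative (\<lambda>h. dir_deriv (dir_deriv F k) h x)) (at x)"
  by (rule has_derivative_transform_within_open[OF has_derivative_dir_deriv[OF differentiable_F(2)[OF assms]], of "interior K"])
     (use assms dir_deriv_eq_gradient in auto)

text \<open>Linearity in \<open>h\<close> is differentiability. Linearity in \<open>k\<close> is not
  automatic, as \<open>k\<close> selects the function being differentiated; it comes from expanding
  the gradient term in coordinates first.\<close>

lemma dir_deriv2_eq_hessian:
  assumes "x \<in> interior K"
  shows "dir_deriv (dir_deriv F k) h x = h \<bullet> (H x *v k)"
proof -
  let ?D = "\<lambda>k h. dir_deriv (dir_deriv F k) h x"
  have lin: "linear (?D k)" for k
    using linear_dir_deriv[OF differentiable_F(2)[OF assms]] .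
  have "((\<lambda>x. \<Sum>j\<in>UNIV. k $ j * (g x \<bullet> axis j 1)) has_derivative (\<lambda>h. \<Sum>j\<in>UNIV. k $ j * ?D (axis j 1) h)) (at x)"
    by (intro has_derivative_sum has_derivative_mult_right has_derivative_inner_gradient assms)
  moreover have "(\<Sum>j\<in>UNIV. k $ j * (g x \<bullet> axis j 1)) = g x \<bullet> k" for x
    by (simp add: inner_vec_def[of "g x" k] inner_axis mult.commute)
  ultimately have "?D k h = (\<Sum>j\<in>UNIV. k $ j * ?D (axis j 1) h)"
    using has_derivative_inner_gradient[OF assms, of k]
    by (auto dest: has_derivative_unique fun_cong)
  also have "\<dots> = (\<Sum>j\<in>UNIV. k $ j * (\<Sum>i\<in>UNIV. h $ i * ?D (axis j 1) (axis i 1)))"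
  proof -
    have "?D k h = (\<Sum>i\<in>UNIV. h $ i * ?D k (axis i 1))" for k
      using linear_sum[OF lin[of k], of "\<lambda>i. h $ i *\<^sub>R axis i 1" UNIV] basis_expansion[of h]
      by (simp add: scalar_mult_eq_scaleR linear_cmul[OF lin])
    then show ?thesis by (auto intro: sum.cong)
  qed
  also have "\<dots> = (\<Sum>j\<in>UNIV. \<Sum>i\<in>UNIV. h $ i * (?D (axis j 1) (axis i 1) * k $ j))"
    by (auto intro!: sum.cong simp: sum_distrib_left mult_ac)
  also have "\<dots> = h \<bullet> (H x *v k)"
    by (subst sum.swap) (simp add: inner_vec_def hessian_def matrix_vector_mult_def sum_distrib_left)
  finally show ?thesis .
qed

lemma has_derivative_gradient:
  assumes "x \<in> interior K"
  shows "((\<lambda>x. g x \<bullet> k) has_derivative (\<lambda>h. h \<bullet> (H x *v k))) (at x)"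
  using has_derivative_inner_gradient[OF assms] by (simp add: dir_deriv2_eq_hessian[OF assms])

lemma hessian_sym:
  assumes "x \<in> interior K"
  shows "h \<bullet> (H x *v k) = k \<bullet> (H x *v h)"
proof -
  have "C_on 2 F (interior K)"
    using C3 differentiable_F
    by (auto simp: numeral_3_eq_3 numeral_2_eq_2 intro!: differentiable_imp_continuous_on
        differentiable_at_imp_differentiable_on)
  from dir_deriv_commute[OF this _ assms]
  show ?thesis by (simp add: dir_deriv2_eq_hessian[OF assms])
qed

lemma has_derivative_hessian:
  assumes "x \<in> interior K"
  shows "((\<lambda>x. h \<bullet> (H x *v k)) has_derivative (\<lambda>l. third x l h k)) (at x)"
  unfolding third_def
  by (rule has_derivative_transform_within_open[OF has_derivative_dir_deriv[OF differentiable_F(3)[OF assms]], of "interior K"])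
     (use assms dir_deriv2_eq_hessian in auto)

lemma third_swap12:
  assumes "x \<in> interior K" shows "third x l h k = third x h l k"
proof -
  have "C_on 2 (dir_deriv F k) (interior K)"
    using C3 by (auto simp: numeral_3_eq_3 numeral_2_eq_2)
  from dir_deriv_commute[OF this _ assms] show ?thesis by (simp add: third_def)
qed

text \<open>The symmetry of the Hessian is an identity on an open set, so it may be differentiated.
  With \<open>third_swap12\<close> this generates all permutations of the arguments.\<close>

lemma third_swap23:
  assumes "x \<in> interior K" shows "third x l h k = third x l k h"
  unfolding third_def
  by (rule dir_deriv_cong_open[of "interior K"])
     (use assms hessian_sym in \<open>auto simp: dir_deriv2_eq_hessian intro: differentiable_F\<close>)

lemma linear_third:
  assumes "x \<in> interior K"
  shows "linear (\<lambda>l. third x l h k)"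
  using has_derivative_linear[OF has_derivative_hessian[OF assms]] .

lemma third_simps:
  assumes x: "x \<in> interior K"
  shows "third x (a + b) h k = third x a h k + third x b h k"
    "third x h (a + b) k = third x h a k + third x h b k"
    "third x h k (a + b) = third x h k a + third x h k b"
    "third x (a - b) h k = third x a h k - third x b h k"
    "third x h (a - b) k = third x h a k - third x h b k"
    "third x h k (a - b) = third x h k a - third x h k b"
    "third x (r *\<^sub>R a) h k = r * third x a h k"
    "third x h (r *\<^sub>R a) k = r * third x h a k"
    "third x h k (r *\<^sub>R a) = r * third x h k a"
proof -
  have 1: "third x (a + b) h k = third x a h k + third x b h k"
    "third x (a - b) h k = third x a h k - third x b h k"
    "third x (r *\<^sub>R a) h k = r * third x a h k" for a b h k r
    by (rule linear_add[OF linear_third[OF x]] linear_diff[OF linear_third[OF x]] linear_cmul[OF linear_third[OF x], simplified])+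
  then have 2: "third x h (a + b) k = third x h a k + third x h b k"
    "third x h (a - b) k = third x h a k - third x h b k"
    "third x h (r *\<^sub>R a) k = r * third x h a k" for a b h k r
    using third_swap12[OF x, of h] by simp_all
  then show "third x h k (a + b) = third x h k a + third x h k b"
    "third x h k (a - b) = third x h k a - third x h k b"
    "third x h k (r *\<^sub>R a) = r * third x h k a"
    using third_swap23[OF x, of h k] by simp_all
  show "third x (a + b) h k = third x a h k + third x b h k"
    "third x (a - b) h k = third x a h k - third x b h k"
    "third x (r *\<^sub>R a) h k = r * third x a h k"
    "third x h (a + b) k = third x h a k + third x h b k"
    "third x h (a - b) k = third x h a k - third x h b k"
    "third x h (r *\<^sub>R a) k = r * third x h a k"
    using 1 2 by simp_all
qed

section \<open>Consequences of convexity\<close>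

lemma above_tangent:
  assumes x: "x \<in> interior K" and y: "y \<in> interior K"
  shows "F x + g x \<bullet> (y - x) \<le> F y"
proof (rule ccontr)
  assume "\<not> ?thesis"
  then have pos: "g x \<bullet> (y - x) - (F y - F x) > 0" by simp
  define \<psi> where "\<psi> = (\<lambda>t. F (x + t *\<^sub>R (y - x)) - t * (F y - F x))"
  have "(\<psi> has_real_derivative (g x \<bullet> (y - x) - (F y - F x))) (at 0)"
    unfolding \<psi>_def
    using has_real_derivative_along_line[OF has_derivative_F, of x 0 "y - x"] x
    by (auto intro!: derivative_eq_intros)
  from DERIV_pos_inc_right[OF this pos]
  obtain d where d: "d > 0" "\<And>t. t > 0 \<Longrightarrow> t < d \<Longrightarrow> \<psi> 0 < \<psi> t" by auto
  define t where "t = min (d / 2) 1"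
  have t: "0 < t" "t < d" "t \<le> 1" using d(1) by (auto simp: t_def)
  have "F ((1 - t) *\<^sub>R x + t *\<^sub>R y) \<le> (1 - t) * F x + t * F y"
    using lhscb t x y unfolding lhscb_def by (intro convex_onD) auto
  then have "\<psi> t \<le> \<psi> 0" by (simp add: \<psi>_def algebra_simps)
  with d(2)[of t] t show False by simp
qed

text \<open>Negative curvature would make the slope along \<open>h\<close> drop just after
  \<open>x\<close>, while the two tangent inequalities between \<open>x\<close> and a nearby point
  add up to monotonicity of the gradient.\<close>

lemma hessian_nonneg:
  assumes x: "x \<in> interior K" shows "0 \<le> h \<bullet> (H x *v h)"
proof (rule ccontr)
  assume "\<not> ?thesis"
  then have neg: "h \<bullet> (H x *v h) < 0" by simp
  have "((\<lambda>t. g (x + t *\<^sub>R h) \<bullet> h) has_real_derivative h \<bullet> (H x *v h)) (at 0)"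
    using has_real_derivative_along_line[OF has_derivative_gradient, of x 0 h] x by simp
  from DERIV_neg_dec_right[OF this neg]
  obtain d where d: "d > 0" "\<And>t. t > 0 \<Longrightarrow> t < d \<Longrightarrow> g (x + t *\<^sub>R h) \<bullet> h < g x \<bullet> h" by auto
  have "((\<lambda>t. x + t *\<^sub>R h) \<longlongrightarrow> x + 0 *\<^sub>R h) (at_right 0)"
    by (intro tendsto_intros)
  then have "\<forall>\<^sub>F t in at_right 0. x + t *\<^sub>R h \<in> interior K"
    using x by (intro topological_tendstoD[where S = "interior K"]) auto
  moreover have "\<forall>\<^sub>F t in at_right 0. 0 < t \<and> t < d"
    using d(1) by (auto simp: eventually_at_right_field)
  ultimately have "\<forall>\<^sub>F t in at_right 0. x + t *\<^sub>R h \<in> interior K \<and> 0 < t \<and> t < d"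
    by (rule eventually_conj)
  then obtain t where t: "x + t *\<^sub>R h \<in> interior K" "0 < t" "t < d"
    using eventually_happens'[OF trivial_limit_at_right_real] by blast
  have "0 \<le> t * (g (x + t *\<^sub>R h) \<bullet> h - g x \<bullet> h)"
    using above_tangent[OF x t(1)] above_tangent[OF t(1) x] by (simp add: algebra_simps)
  then have "g x \<bullet> h \<le> g (x + t *\<^sub>R h) \<bullet> h" using t(2) by (simp add: zero_le_mult_iff)
  with d(2)[OF t(2,3)] show False by simp
qed

lemma third_diag:
  assumes "x \<in> interior K"
  shows "\<bar>third x h h h\<bar> \<le> 2 * (h \<bullet> (H x *v h)) powr (3/2)"
proof -
  have "\<bar>dir_deriv (dir_deriv (dir_deriv F h) h) h x\<bar> \<le> 2 * (dir_deriv (dir_deriv F h) h x) powr (3/2)"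
    using lhscb assms unfolding lhscb_def by blast
  then show ?thesis by (simp add: third_def dir_deriv2_eq_hessian[OF assms])
qed

lemmas line_derivs =
  has_real_derivative_along_line[OF has_derivative_F]
  has_real_derivative_along_line[OF has_derivative_gradient]
  has_real_derivative_along_line[OF has_derivative_hessian]

end

section \<open>Self-concordance along a line\<close>

lemma powr_three_halves:
  assumes "0 \<le> (w::real)" shows "w powr (3/2) = w * sqrt w"
proof -
  have "w powr (3/2) = w powr (1 + 1/2)" by simp
  also have "\<dots> = w powr 1 * w powr (1/2)" by (rule powr_add)
  finally show ?thesis using assms by (simp add: powr_half_sqrt)
qed

text \<open>\<open>w\<close> is the second derivative of the barrier along a line, and
  self-concordance says that w^(-1/2) has slope at most 1 in absolute value. The shift
  \<open>e\<close> allows \<open>w\<close> to vanish and preserves the bound, because it only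
  enlarges the denominator.\<close>

lemma inverse_sqrt_lipschitz:
  fixes w w' :: "real \<Rightarrow> real"
  assumes T: "0 \<le> T" and e: "0 \<le> e"
    and w: "\<And>t. 0 \<le> t \<Longrightarrow> t \<le> T \<Longrightarrow> (w has_real_derivative w' t) (at t)"
    and nonneg: "\<And>t. 0 \<le> t \<Longrightarrow> t \<le> T \<Longrightarrow> 0 \<le> w t"
    and pos: "\<And>t. 0 \<le> t \<Longrightarrow> t \<le> T \<Longrightarrow> 0 < w t + e"
    and sc: "\<And>t. 0 \<le> t \<Longrightarrow> t \<le> T \<Longrightarrow> \<bar>w' t\<bar> \<le> 2 * w t powr (3/2)"
  shows "\<bar>1 / sqrt (w T + e) - 1 / sqrt (w 0 + e)\<bar> \<le> T"
proof -
  define f where "f = (\<lambda>t. 1 / sqrt (w t + e))"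
  define f' where "f' = (\<lambda>t. - w' t / (2 * ((w t + e) * sqrt (w t + e))))"
  have df: "(f has_real_derivative f' t) (at t)" if t: "0 \<le> t" "t \<le> T" for t
  proof -
    have 1: "((\<lambda>t. w t + e) has_real_derivative w' t) (at t)"
      using w[OF t] by (auto intro!: derivative_eq_intros)
    have "((\<lambda>t. sqrt (w t + e)) has_real_derivative (inverse (sqrt (w t + e)) / 2 * w' t)) (at t)"
      by (rule DERIV_chain2[OF DERIV_real_sqrt 1]) (use pos[OF t] in auto)
    then have "(f has_real_derivative
        (0 * sqrt (w t + e) - 1 * (inverse (sqrt (w t + e)) / 2 * w' t)) / (sqrt (w t + e) * sqrt (w t + e))) (at t)"
      unfolding f_def by (intro DERIV_divide DERIV_const) (use pos[OF t] in auto)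
    moreover have "(0 * sqrt (w t + e) - 1 * (inverse (sqrt (w t + e)) / 2 * w' t)) / (sqrt (w t + e) * sqrt (w t + e)) = f' t"
      using pos[OF t] by (simp add: f'_def divide_simps)
    ultimately show ?thesis by simp
  qed
  have bound: "\<bar>f' t\<bar> \<le> 1" if t: "0 \<le> t" "t \<le> T" for t
  proof -
    have "\<bar>w' t\<bar> \<le> 2 * (w t * sqrt (w t))"
      using sc[OF t] powr_three_halves[OF nonneg[OF t]] by simp
    also have "\<dots> \<le> 2 * ((w t + e) * sqrt (w t + e))"
      using nonneg[OF t] e by (intro mult_left_mono mult_mono) auto
    finally show ?thesis using pos[OF t] by (simp add: f'_def abs_mult)
  qed
  have "f 0 + 0 \<le> f T + T"
    using bound df T by (intro DERIV_nonneg_imp_nondecreasing[of 0 T "\<lambda>t. f t + t"])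
      (auto intro!: exI derivative_eq_intros simp: abs_le_iff, smt (verit))
  moreover have "f T - T \<le> f 0 - 0"
    using bound df T by (intro DERIV_nonpos_imp_nonincreasing[of 0 T "\<lambda>t. f t - t"])
      (auto intro!: exI derivative_eq_intros simp: abs_le_iff)
  ultimately show ?thesis by (simp add: f_def abs_le_iff)
qed

context lhscb_cone
begin

definition local_norm :: "real^'n \<Rightarrow> real^'n \<Rightarrow> real" where
  "local_norm x u = sqrt (u \<bullet> (H x *v u))"

lemma local_norm_nonneg [simp]: "x \<in> interior K \<Longrightarrow> 0 \<le> local_norm x u"
  by (simp add: local_norm_def hessian_nonneg)

lemma local_norm_sq: "x \<in> interior K \<Longrightarrow> (local_norm x u)\<^sup>2 = u \<bullet> (H x *v u)"
  by (simp add: local_norm_def hessian_nonneg)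

lemma local_norm_scale: "local_norm x (r *\<^sub>R u) = \<bar>r\<bar> * local_norm x u"
proof -
  have "(r *\<^sub>R u) \<bullet> (H x *v (r *\<^sub>R u)) = r\<^sup>2 * (u \<bullet> (H x *v u))"
    by (simp add: matrix_vector_mult_scaleR power2_eq_square)
  then show ?thesis by (simp add: local_norm_def real_sqrt_mult)
qed

lemma local_norm_minus [simp]: "local_norm x (- u) = local_norm x u"
  using local_norm_scale[of x "-1" u] by simp

lemma third_diag':
  assumes "x \<in> interior K"
  shows "\<bar>third x h h h\<bar> \<le> 2 * (local_norm x h)^3"
  using third_diag[OF assms, of h] hessian_nonneg[OF assms, of h] local_norm_sq[OF assms, of h]
  by (simp add: powr_three_halves local_norm_def power3_eq_cube)

lemma local_norm_along_line:
  assumes T: "0 \<le> T" and seg: "\<And>t. 0 \<le> t \<Longrightarrow> t \<le> T \<Longrightarrow> x + t *\<^sub>R u \<in> interior K"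
    and a: "local_norm x u < a" "a * T < 1"
  shows "local_norm (x + T *\<^sub>R u) u \<le> a / (1 - a * T)"
proof -
  have x: "x \<in> interior K" using seg[of 0] T by simp
  have apos: "a > 0" using a(1) local_norm_nonneg[OF x, of u] by linarith
  define w where "w = (\<lambda>t. u \<bullet> (H (x + t *\<^sub>R u) *v u))"
  \<comment> \<open>The shifted starting value is then exactly \<open>a\<^sup>2\<close>. Strictness
    of the bound \<open>a\<close> makes \<open>e\<close> positive even if the local norm of
    \<open>u\<close> is 0.\<close>
  define e where "e = a\<^sup>2 - w 0"
  have "(local_norm x u)\<^sup>2 < a\<^sup>2"
    using a(1) local_norm_nonneg[OF x, of u] by (intro power_strict_mono) auto
  then have e: "e > 0" by (simp add: e_def w_def local_norm_sq[OF x])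
  have w0: "0 \<le> w t" if "0 \<le> t" "t \<le> T" for t using hessian_nonneg[OF seg[OF that]] by (simp add: w_def)
  have "\<bar>1 / sqrt (w T + e) - 1 / sqrt (w 0 + e)\<bar> \<le> T"
  proof (rule inverse_sqrt_lipschitz[OF T, of e w "\<lambda>t. third (x + t *\<^sub>R u) u u u"])
    show "(w has_real_derivative third (x + t *\<^sub>R u) u u u) (at t)" if "0 \<le> t" "t \<le> T" for t
      unfolding w_def by (rule line_derivs(3)[OF seg[OF that]])
    show "\<bar>third (x + t *\<^sub>R u) u u u\<bar> \<le> 2 * w t powr (3 / 2)" if "0 \<le> t" "t \<le> T" for t
      unfolding w_def by (rule third_diag[OF seg[OF that]])
  qed (use e w0 in \<open>auto intro: add_nonneg_pos\<close>)
  then have *: "1 / a - T \<le> 1 / sqrt (w T + e)" using apos by (simp add: e_def)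
  have "0 < 1 - a * T" using a(2) by simp
  moreover have "(1 - a * T) / a \<le> 1 / sqrt (w T + e)" using * apos by (simp add: field_simps)
  moreover have s: "0 < sqrt (w T + e)" using w0[of T] e T by (simp add: add_nonneg_pos)
  ultimately have "sqrt (w T + e) \<le> a / (1 - a * T)" using apos by (simp add: field_simps)
  moreover have "local_norm (x + T *\<^sub>R u) u \<le> sqrt (w T + e)" using e by (simp add: local_norm_def w_def)
  ultimately show ?thesis by linarith
qed

section \<open>Geometry of the cone\<close>

lemma closed_K: "closed K" and convex_K: "convex K" and cone_K: "cone K"
  and pointed_K: "x \<in> K \<Longrightarrow> - x \<in> K \<Longrightarrow> x = 0"
proof -
  show "closed K" "convex K" "cone K" using proper by (auto simp: proper_cone_def)
  assume "x \<in> K" "- x \<in> K"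
  then have "x \<in> K \<inter> uminus ` K" by (metis IntI image_eqI minus_minus)
  then show "x = 0" using proper by (auto simp: proper_cone_def)
qed

lemma K_add: "x \<in> K \<Longrightarrow> y \<in> K \<Longrightarrow> x + y \<in> K"
  and K_scale: "x \<in> K \<Longrightarrow> 0 \<le> r \<Longrightarrow> r *\<^sub>R x \<in> K"
  using convex_K cone_K convex_cone[of K] by blast+

lemma interior_add_cone:
  assumes "x \<in> interior K" "u \<in> K" shows "x + u \<in> interior K"
proof -
  have "open ((+) u ` interior K)" by (simp add: open_translation)
  moreover have "(+) u ` interior K \<subseteq> K"
    using K_add assms(2) interior_subset by blast
  ultimately have "(+) u ` interior K \<subseteq> interior K" by (rule interior_maximal[rotated])
  then show ?thesis using assms(1) by (auto simp: add.commute)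
qed

lemma interior_scale:
  assumes "x \<in> interior K" "t > 0" shows "t *\<^sub>R x \<in> interior K"
proof -
  have "open ((*\<^sub>R) t ` interior K)" using assms(2) by (simp add: open_scaling)
  moreover have "(*\<^sub>R) t ` interior K \<subseteq> K"
    using K_scale assms(2) interior_subset by (auto intro: less_imp_le)
  ultimately have "(*\<^sub>R) t ` interior K \<subseteq> interior K" by (rule interior_maximal[rotated])
  then show ?thesis using assms(1) by auto
qed

lemma interior_nonzero:
  assumes "x \<in> interior K" shows "x \<noteq> 0"
proof
  assume "x = 0"
  then obtain e where e: "e > 0" "ball 0 e \<subseteq> K"
    using assms by (auto simp: mem_interior)
  \<comment> \<open>Any coordinate serves: an index type is nonempty, so a nonzero vector
    exists.\<close>
  define v :: "real^'n" where "v = (e / 2) *\<^sub>R axis undefined 1"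
  have "norm v < e" "v \<noteq> 0" using e(1) by (auto simp: v_def axis_eq_0_iff)
  moreover have "v \<in> K" "- v \<in> K" using e(2) \<open>norm v < e\<close> by (auto simp: subset_iff)
  ultimately show False using pointed_K by blast
qed

section \<open>The Dikin ellipsoid and definiteness of the Hessian\<close>

lemma bounded_barrier_extends:
  assumes T: "0 < T" and seg: "\<And>t. 0 \<le> t \<Longrightarrow> t < T \<Longrightarrow> x + t *\<^sub>R u \<in> interior K"
    and B: "\<And>t. 0 \<le> t \<Longrightarrow> t < T \<Longrightarrow> F (x + t *\<^sub>R u) \<le> B"
  shows "x + T *\<^sub>R u \<in> interior K"
proof (rule ccontr)
  assume notin: "x + T *\<^sub>R u \<notin> interior K"
  define t where "t = (\<lambda>k::nat. T - T / (real k + 1))"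
  have t: "0 \<le> t k" "t k < T" for k using T by (auto simp: t_def field_simps)
  have "(\<lambda>k. T - T * inverse (real (Suc k))) \<longlonglongrightarrow> T - T * 0"
    by (intro tendsto_intros LIMSEQ_inverse_real_of_nat)
  then have lim: "t \<longlonglongrightarrow> T" by (simp add: t_def field_simps)
  define y where "y = (\<lambda>k. x + t k *\<^sub>R u)"
  have y: "y k \<in> interior K" for k using seg[OF t] by (simp add: y_def)
  have ylim: "y \<longlonglongrightarrow> x + T *\<^sub>R u" unfolding y_def by (intro tendsto_intros lim)
  then have "x + T *\<^sub>R u \<in> closure K"
    using y interior_subset closure_sequential by (metis subsetD)
  then have "x + T *\<^sub>R u \<in> frontier K" using notin by (simp add: frontier_def)
  then have "filterlim (\<lambda>k. F (y k)) at_top sequentially"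
    using lhscb y ylim unfolding lhscb_def by blast
  then have "\<forall>\<^sub>F k in sequentially. B + 1 \<le> F (y k)" by (simp add: filterlim_at_top)
  then obtain k where "B + 1 \<le> F (y k)" by (meson eventually_sequentially order_refl)
  then show False using B[OF t, of k] by (simp add: y_def)
qed

text \<open>If the segment left the interior, then before the first exit time the second derivative
  along \<open>u\<close> would be bounded, hence also the slope and \<open>F\<close> itself, and a
  bounded barrier cannot reach the boundary.\<close>

lemma dikin_ellipsoid:
  assumes x: "x \<in> interior K" and u: "local_norm x u < 1"
  shows "x + u \<in> interior K"
proof (rule ccontr)
  assume notin: "x + u \<notin> interior K"
  \<comment> \<open>A closed set of exit times in a compact interval, so a first exit time exists
    and its point lies outside the interior.\<close>
  define S where "S = {0..1} \<inter> (\<lambda>t. x + t *\<^sub>R u) -` (- interior K)"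
  have "closed S" unfolding S_def
    by (intro continuous_closed_preimage continuous_intros) auto
  then have "compact S" using compact_Int_closed[of "{0..1}" S] by (simp add: S_def Int_absorb1)
  moreover have "1 \<in> S" using notin by (simp add: S_def)
  ultimately obtain T where T: "T \<in> S" "\<And>t. t \<in> S \<Longrightarrow> T \<le> t"
    using compact_attains_inf[of S] by blast
  have "T \<noteq> 0" using T(1) x by (auto simp: S_def)
  then have T0: "0 < T" "T \<le> 1" "x + T *\<^sub>R u \<notin> interior K" using T(1) by (auto simp: S_def)
  have seg: "x + t *\<^sub>R u \<in> interior K" if "0 \<le> t" "t < T" for t
    using T(2)[of t] that T0(2) by (auto simp: S_def)
  obtain a where a: "local_norm x u < a" "a < 1" using u dense by blast
  have a0: "0 < a" using a(1) local_norm_nonneg[OF x, of u] by linarith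
  define M where "M = (a / (1 - a))\<^sup>2"
  have M: "u \<bullet> (H (x + t *\<^sub>R u) *v u) \<le> M" if t: "0 \<le> t" "t < T" for t
  proof -
    have at: "a * t \<le> a" using a0 that T0(2) by (simp add: mult_left_le)
    then have at1: "a * t < 1" using a(2) by linarith
    have "local_norm (x + t *\<^sub>R u) u \<le> a / (1 - a * t)"
      by (rule local_norm_along_line) (use t seg a at1 in auto)
    also have "\<dots> \<le> a / (1 - a)" using a a0 at at1 by (intro divide_left_mono mult_pos_pos) auto
    finally have "(local_norm (x + t *\<^sub>R u) u)\<^sup>2 \<le> M"
      unfolding M_def using local_norm_nonneg[OF seg[OF t]] by (intro power_mono) auto
    then show ?thesis using local_norm_sq[OF seg[OF t]] by simp
  qed
  have M0: "M \<ge> 0" by (simp add: M_def)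
  have "F (x + t *\<^sub>R u) \<le> F x + \<bar>g x \<bullet> u\<bar> + M" if t: "0 \<le> t" "t < T" for t
  proof -
    have slope: "g (x + t *\<^sub>R u) \<bullet> u \<le> g x \<bullet> u + M"
    proof (cases "t = 0")
      case False
      then have "0 < t" using t by simp
      have D: "((\<lambda>t. g (x + t *\<^sub>R u) \<bullet> u) has_real_derivative u \<bullet> (H (x + z *\<^sub>R u) *v u)) (at z)"
        if "0 \<le> z" "z \<le> t" for z
        using that t by (intro line_derivs(2) seg) auto
      obtain z where z: "0 < z" "z < t"
        "g (x + t *\<^sub>R u) \<bullet> u - g (x + 0 *\<^sub>R u) \<bullet> u = (t - 0) * (u \<bullet> (H (x + z *\<^sub>R u) *v u))"
        using MVT2[OF \<open>0 < t\<close> D] by auto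
      have "t * (u \<bullet> (H (x + z *\<^sub>R u) *v u)) \<le> 1 * M"
        using M[of z] z t T0 hessian_nonneg[OF seg, of z u] by (intro mult_mono) auto
      then show ?thesis using z(3) by simp
    qed (use M0 in simp)
    \<comment> \<open>The tangent is taken at the moving point and evaluated at \<open>x\<close>,
      which turns convexity into an upper bound.\<close>
    have "F (x + t *\<^sub>R u) \<le> F x + t * (g (x + t *\<^sub>R u) \<bullet> u)"
      using above_tangent[OF seg[OF t] x] by simp
    also have "t * (g (x + t *\<^sub>R u) \<bullet> u) \<le> t * (\<bar>g x \<bullet> u\<bar> + M)"
      using slope t by (intro mult_left_mono) auto
    also have "\<dots> \<le> \<bar>g x \<bullet> u\<bar> + M" using t T0 M0 by (intro mult_left_le_one_le) auto
    finally show ?thesis by simp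
  qed
  from bounded_barrier_extends[OF T0(1) seg this] T0(3) show False by blast
qed

text \<open>A null vector of the Hessian would span a line contained in \<^term>\<open>K\<close>.\<close>

lemma hessian_pos:
  assumes x: "x \<in> interior K" and h: "h \<noteq> 0"
  shows "0 < h \<bullet> (H x *v h)"
proof (rule ccontr)
  assume "\<not> ?thesis"
  then have "local_norm x h = 0" using hessian_nonneg[OF x, of h] by (simp add: local_norm_def)
  have "v \<in> K" if "local_norm x v = 0" for v
  proof -
    have "x + real (Suc k) *\<^sub>R v \<in> K" for k
      using dikin_ellipsoid[OF x, of "real (Suc k) *\<^sub>R v"] that interior_subset[of K]
      by (auto simp: local_norm_scale)
    then have "inverse (real (Suc k)) *\<^sub>R (x + real (Suc k) *\<^sub>R v) \<in> K" for k
      by (intro K_scale) auto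
    then have "inverse (real (Suc k)) *\<^sub>R x + v \<in> K" for k
      by (simp add: scaleR_add_right del: of_nat_Suc)
    moreover have "(\<lambda>k. inverse (real (Suc k)) *\<^sub>R x + v) \<longlonglongrightarrow> 0 *\<^sub>R x + v"
      by (intro tendsto_intros LIMSEQ_inverse_real_of_nat)
    ultimately have "0 *\<^sub>R x + v \<in> K"
      by (rule closed_sequentially[OF closed_K])
    then show ?thesis by simp
  qed
  then have "h \<in> K" "- h \<in> K" using \<open>local_norm x h = 0\<close> by auto
  then show False using h pointed_K by blast
qed

lemma local_norm_pos: "x \<in> interior K \<Longrightarrow> u \<noteq> 0 \<Longrightarrow> 0 < local_norm x u"
  by (simp add: local_norm_def hessian_pos)

lemma hessian_cauchy_schwarz:
  assumes x: "x \<in> interior K"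
  shows "\<bar>h \<bullet> (H x *v k)\<bar> \<le> local_norm x h * local_norm x k"
proof (cases "k = 0")
  case False
  define b c where "b = h \<bullet> (H x *v k)" and "c = k \<bullet> (H x *v k)"
  have c: "c > 0" using hessian_pos[OF x False] by (simp add: c_def)
  have kh: "k \<bullet> (H x *v h) = b" using hessian_sym[OF x] by (simp add: b_def)
  have "0 \<le> (c *\<^sub>R h - b *\<^sub>R k) \<bullet> (H x *v (c *\<^sub>R h - b *\<^sub>R k))" by (rule hessian_nonneg[OF x])
  also have "\<dots> = c * (c * (h \<bullet> (H x *v h)) - b\<^sup>2)"
    unfolding matrix_vector_mult_diff_distrib matrix_vector_mult_scaleR
    by (simp add: inner_diff_left inner_diff_right kh flip: b_def c_def) (simp add: algebra_simps power2_eq_square)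
  finally have "b\<^sup>2 \<le> (h \<bullet> (H x *v h)) * c" using c by (simp add: zero_le_mult_iff mult.commute)
  then have "b\<^sup>2 \<le> (local_norm x h * local_norm x k)\<^sup>2"
    by (simp add: power_mult_distrib local_norm_sq[OF x] c_def)
  then have "\<bar>b\<bar> \<le> \<bar>local_norm x h * local_norm x k\<bar>" by (simp only: abs_le_square_iff)
  then show ?thesis using x by (simp add: b_def abs_mult)
qed (use x in \<open>simp add: local_norm_def\<close>)

section \<open>Logarithmic homogeneity\<close>

lemma gradient_inner_self:
  assumes x: "x \<in> interior K" shows "g x \<bullet> x = - \<nu>"
proof -
  have "((\<lambda>t. F (0 + t *\<^sub>R x)) has_real_derivative g x \<bullet> x) (at 1)"
    using line_derivs(1)[of 0 1 x] x by simp
  moreover have "((\<lambda>t. F x - \<nu> * ln t) has_real_derivative - \<nu>) (at 1)"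
    by (auto intro!: derivative_eq_intros)
  then have "((\<lambda>t. F (0 + t *\<^sub>R x)) has_real_derivative - \<nu>) (at 1)"
    by (rule has_field_derivative_transform_within_open[where S = "{0<..}"])
       (use lhscb x in \<open>auto simp: lhscb_def\<close>)
  ultimately show ?thesis using DERIV_unique by blast
qed

lemma gradient_scale:
  assumes x: "x \<in> interior K" and t: "t > 0" shows "g (t *\<^sub>R x) \<bullet> h = (g x \<bullet> h) / t"
proof -
  have "((\<lambda>y. F (t *\<^sub>R y)) has_derivative (\<lambda>h. g (t *\<^sub>R x) \<bullet> (t *\<^sub>R h))) (at x)"
    by (rule has_derivative_compose[where f = "\<lambda>y. t *\<^sub>R y"])
       (auto intro!: derivative_eq_intros has_derivative_F interior_scale x t)
  moreover have "((\<lambda>y. F y - \<nu> * ln t) has_derivative (\<lambda>h. g x \<bullet> h)) (at x)"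
    using has_derivative_F[OF x] by (auto intro!: derivative_eq_intros)
  then have "((\<lambda>y. F (t *\<^sub>R y)) has_derivative (\<lambda>h. g x \<bullet> h)) (at x)"
    by (rule has_derivative_transform_within_open[where s = "interior K"])
       (use lhscb x t in \<open>auto simp: lhscb_def\<close>)
  ultimately have "g (t *\<^sub>R x) \<bullet> (t *\<^sub>R h) = g x \<bullet> h"
    by (auto dest: has_derivative_unique fun_cong)
  then show ?thesis using t by (simp add: field_simps)
qed

text \<open>The weak form of H x = - g, from differentiating the homogeneity of the gradient,
  \<open>gradient_scale\<close>, at \<open>t = 1\<close>.\<close>

lemma hessian_self:
  assumes x: "x \<in> interior K" shows "x \<bullet> (H x *v h) = - (g x \<bullet> h)" "h \<bullet> (H x *v x) = - (g x \<bullet> h)"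
proof -
  have "((\<lambda>t. g (0 + t *\<^sub>R x) \<bullet> h) has_real_derivative x \<bullet> (H x *v h)) (at 1)"
    using line_derivs(2)[of 0 1 x h] x by simp
  moreover have "((\<lambda>t. (g x \<bullet> h) / t) has_real_derivative - (g x \<bullet> h)) (at 1)"
    by (auto intro!: derivative_eq_intros)
  then have "((\<lambda>t. g (0 + t *\<^sub>R x) \<bullet> h) has_real_derivative - (g x \<bullet> h)) (at 1)"
    by (rule has_field_derivative_transform_within_open[where S = "{0<..}"])
       (use x gradient_scale in auto)
  ultimately show "x \<bullet> (H x *v h) = - (g x \<bullet> h)" using DERIV_unique by blast
  then show "h \<bullet> (H x *v x) = - (g x \<bullet> h)" using hessian_sym[OF x] by simp
qed

lemma local_norm_self: "x \<in> interior K \<Longrightarrow> local_norm x x = sqrt \<nu>"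
  by (simp add: local_norm_def hessian_self gradient_inner_self)

lemma nu_pos: "0 < \<nu>"
proof -
  obtain x where x: "x \<in> interior K" using proper by (auto simp: proper_cone_def)
  from hessian_pos[OF x interior_nonzero[OF x]] show ?thesis
    by (simp add: hessian_self[OF x] gradient_inner_self[OF x])
qed

lemma abs_gradient_le:
  assumes x: "x \<in> interior K" shows "\<bar>g x \<bullet> h\<bar> \<le> sqrt \<nu> * local_norm x h"
  using hessian_cauchy_schwarz[OF x, of x h] by (simp add: local_norm_self[OF x] hessian_self[OF x])

text \<open>For \<open>t \<ge> 1\<close> homogeneity gives F (t y) <= F y, whereas a positive slope
  would let the tangent plane at \<open>x\<close> grow linearly along the ray through
  \<open>y\<close>.\<close>

lemma gradient_nonpos:
  assumes x: "x \<in> interior K" and u: "u \<in> K" shows "g x \<bullet> u \<le> 0"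
proof -
  have "g x \<bullet> y \<le> 0" if y: "y \<in> interior K" for y
  proof (rule ccontr)
    assume "\<not> ?thesis"
    then have c: "g x \<bullet> y > 0" by simp
    define C where "C = F y - F x + g x \<bullet> x"
    define t where "t = max 1 ((C + 1) / (g x \<bullet> y))"
    have t: "t \<ge> 1" by (simp add: t_def)
    have "F x + g x \<bullet> (t *\<^sub>R y - x) \<le> F (t *\<^sub>R y)"
      by (rule above_tangent[OF x interior_scale[OF y]]) (use t in simp)
    also have "\<dots> = F y - \<nu> * ln t" using lhscb y t by (auto simp: lhscb_def)
    also have "\<dots> \<le> F y" using nu_pos t by simp
    finally have "t * (g x \<bullet> y) \<le> C" by (simp add: C_def inner_diff_right)
    moreover have "(C + 1) / (g x \<bullet> y) \<le> t" by (simp add: t_def)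
    ultimately show False using c by (simp add: field_simps)
  qed
  then have "interior K \<subseteq> {y. g x \<bullet> y \<le> 0}" by blast
  then have "closure (interior K) \<subseteq> {y. g x \<bullet> y \<le> 0}"
    by (intro closure_minimal closed_halfspace_le)
  moreover have "closure (interior K) = K"
    using convex_closure_interior[OF convex_K] x closed_K by auto
  ultimately show ?thesis using u by auto
qed

text \<open>Along the ray \<open>x + t u\<close> the slope of \<^term>\<open>F\<close> stays nonpositive, while self-concordance
  forces the second derivative to be at least \<open>(1 / r + t)\<^sup>-\<^sup>2\<close> with \<open>r\<close> the local norm
  of \<open>u\<close>; integrating over the whole ray leaves room for an increase of \<open>r\<close>.\<close>

lemma local_norm_le_neg_gradient:
  assumes x: "x \<in> interior K" and u: "u \<in> K"
  shows "local_norm x u \<le> - (g x \<bullet> u)"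
proof (cases "u = 0")
  case False
  have ray: "x + t *\<^sub>R u \<in> interior K" if "0 \<le> t" for t
    using interior_add_cone[OF x K_scale[OF u that]] .
  define r where "r = local_norm x u"
  have r: "r > 0" using local_norm_pos[OF x False] by (simp add: r_def)
  define w where "w = (\<lambda>t. u \<bullet> (H (x + t *\<^sub>R u) *v u))"
  have wpos: "w t > 0" if "0 \<le> t" for t using hessian_pos[OF ray[OF that] False] by (simp add: w_def)
  have low: "(1 / (1 / r + t))\<^sup>2 \<le> w t" if t: "0 \<le> t" for t
  proof -
    have "\<bar>1 / sqrt (w t + 0) - 1 / sqrt (w 0 + 0)\<bar> \<le> t"
    proof (rule inverse_sqrt_lipschitz[OF t, of 0 w "\<lambda>t. third (x + t *\<^sub>R u) u u u"])
      show "(w has_real_derivative third (x + t *\<^sub>R u) u u u) (at t)" if "0 \<le> t" for t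
        unfolding w_def by (rule line_derivs(3)[OF ray[OF that]])
      show "\<bar>third (x + t *\<^sub>R u) u u u\<bar> \<le> 2 * w t powr (3 / 2)" if "0 \<le> t" for t
        unfolding w_def by (rule third_diag[OF ray[OF that]])
    qed (use wpos in \<open>auto intro: less_imp_le\<close>)
    then have "1 / sqrt (w t) \<le> 1 / r + t" by (simp add: w_def r_def local_norm_def)
    moreover have "1 / q \<le> s" if "1 / s \<le> q" "0 < s" "0 < q" for q s :: real
      using that by (simp add: field_simps)
    moreover have "0 < 1 / r + t" using r t by (simp add: add_pos_nonneg)
    ultimately have "1 / (1 / r + t) \<le> sqrt (w t)" using wpos[OF t] by simp
    then have "(1 / (1 / r + t))\<^sup>2 \<le> (sqrt (w t))\<^sup>2" using r t by (intro power_mono) auto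
    then show ?thesis using wpos[OF t] by simp
  qed
  have key: "g x \<bullet> u + r \<le> 1 / T" if T: "T > 0" for T
  proof -
    \<comment> \<open>The second summand has derivative -(1 / (1/r + t))^2, so \<open>low\<close>
      makes \<theta> nondecreasing; its values are \<open>g x \<bullet> u + r\<close> at 0 and at
      most 1/T at \<open>T\<close>.\<close>
    define \<theta> where "\<theta> = (\<lambda>t. g (x + t *\<^sub>R u) \<bullet> u + 1 / (1 / r + t))"
    have "\<theta> 0 \<le> \<theta> T"
    proof (rule DERIV_nonneg_imp_nondecreasing[of 0 T \<theta>])
      fix t assume t: "0 \<le> t" "t \<le> T"
      have "1 / r + t \<noteq> 0" using r t by (smt (verit) divide_pos_pos)
      then have "(\<theta> has_real_derivative w t - (1 / (1 / r + t))\<^sup>2) (at t)"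
        unfolding \<theta>_def w_def
        by (auto intro!: derivative_eq_intros line_derivs(2)[OF ray] simp: t power2_eq_square)
      then show "\<exists>y. (\<theta> has_real_derivative y) (at t) \<and> 0 \<le> y" using low[OF t(1)] by force
    qed (use T in simp)
    moreover have "g (x + T *\<^sub>R u) \<bullet> u \<le> 0" using gradient_nonpos[OF ray u, of T] T by simp
    moreover have "1 / (1 / r + T) \<le> 1 / T" using r T by (intro divide_left_mono mult_pos_pos add_pos_pos) auto
    ultimately show ?thesis by (simp add: \<theta>_def)
  qed
  have "g x \<bullet> u + r \<le> 0 + e" if "e > 0" for e
    using key[of "1 / e"] that by simp
  then have "g x \<bullet> u + r \<le> 0" by (rule field_le_epsilon)
  then show ?thesis by (simp add: r_def)
qed (use x in \<open>simp add: local_norm_def\<close>)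

text \<open>The case \<open>u = x\<close> of \<open>local_norm_le_neg_gradient\<close> reads sqrt
  \<nu> <= \<nu>.\<close>

lemma nu_ge_1: "1 \<le> \<nu>"
proof -
  obtain x where x: "x \<in> interior K" using proper by (auto simp: proper_cone_def)
  have "x \<in> K" using x interior_subset by blast
  from local_norm_le_neg_gradient[OF x this] have "sqrt \<nu> \<le> \<nu>"
    by (simp add: local_norm_self[OF x] gradient_inner_self[OF x])
  then have "1 * sqrt \<nu> \<le> sqrt \<nu> * sqrt \<nu>" using nu_pos by simp
  then have "1 \<le> sqrt \<nu>" using nu_pos by (simp only: mult_le_cancel_right) auto
  then show ?thesis by simp
qed

text \<open>By polarisation. The sharp constant is 2, by Banach's theorem on symmetric multilinear forms.\<close>

lemma third_bound:
  assumes x: "x \<in> interior K"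
  shows "\<bar>third x u h h\<bar> \<le> 4 * local_norm x u * (local_norm x h)\<^sup>2"
proof (cases "u = 0 \<or> h = 0")
  case True
  then show ?thesis
    using third_simps(7)[OF x, of 0] third_simps(8)[OF x, of u 0 _ h] by (auto simp: local_norm_def)
next
  case False
  define a b where "a = local_norm x u" and "b = local_norm x h"
  have ab: "a > 0" "b > 0" using False local_norm_pos[OF x] by (auto simp: a_def b_def)
  define n where "n = a * b"
  have n: "n > 0" using ab by (simp add: n_def)
  \<comment> \<open>Rescaling to a common local norm \<open>n = a * b\<close> lets the parallelogram
    law control \<open>p\<close> and \<open>q\<close> by \<open>n\<close> alone.\<close>
  define U V where "U = b *\<^sub>R u" and "V = a *\<^sub>R h"
  have UV: "local_norm x U = n" "local_norm x V = n"
    using ab by (simp_all add: U_def V_def n_def local_norm_scale a_def b_def mult.commute)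
  define p q where "p = local_norm x (V + U)" and "q = local_norm x (V - U)"
  have "p\<^sup>2 + q\<^sup>2 = 2 * (local_norm x V)\<^sup>2 + 2 * (local_norm x U)\<^sup>2"
    unfolding p_def q_def local_norm_sq[OF x]
    by (simp add: matrix_vector_right_distrib matrix_vector_mult_diff_distrib inner_simps)
  then have pq: "p\<^sup>2 + q\<^sup>2 = 4 * n\<^sup>2" using UV by simp
  have pq0: "p \<ge> 0" "q \<ge> 0" using x by (simp_all add: p_def q_def)
  have "p\<^sup>2 \<le> (2 * n)\<^sup>2" "q\<^sup>2 \<le> (2 * n)\<^sup>2"
    unfolding power_mult_distrib using pq zero_le_power2[of p] zero_le_power2[of q]
    by (simp_all only: power2_eq_square)
  then have "p \<le> 2 * n" "q \<le> 2 * n" using n by (auto intro: power2_le_imp_le)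
  then have "p * p\<^sup>2 + q * q\<^sup>2 \<le> 2 * n * p\<^sup>2 + 2 * n * q\<^sup>2"
    by (intro add_mono mult_right_mono) auto
  also have "\<dots> = 2 * n * (p\<^sup>2 + q\<^sup>2)" by (simp add: algebra_simps)
  also have "\<dots> = 8 * n^3" unfolding pq by (simp add: power2_eq_square power3_eq_cube)
  finally have cubes: "p^3 + q^3 \<le> 8 * n^3" by (simp add: power3_eq_cube power2_eq_square)
  have sym: "third x V U V = third x U V V" "third x V V U = third x U V V"
    "third x U V U = third x V U U" "third x U U V = third x V U U"
    using third_swap12[OF x] third_swap23[OF x] by metis+
  have "third x (V + U) (V + U) (V + U) - third x (V - U) (V - U) (V - U)
      = 6 * third x U V V + 2 * third x U U U"
    by (simp add: third_simps[OF x] sym)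
  moreover have "\<bar>third x (V + U) (V + U) (V + U)\<bar> \<le> 2 * p^3" "\<bar>third x (V - U) (V - U) (V - U)\<bar> \<le> 2 * q^3"
    "\<bar>third x U U U\<bar> \<le> 2 * n^3"
    using third_diag'[OF x] UV by (simp_all add: p_def q_def) metis
  \<comment> \<open>The three diagonal terms contribute 2 (p^3 + q^3) + 4 n^3 <= 20 n^3, which gives
    the constant 10/3, rounded up to 4.\<close>
  ultimately have "6 * \<bar>third x U V V\<bar> \<le> 20 * n^3" using cubes by linarith
  then have "\<bar>third x U V V\<bar> \<le> 4 * n^3" using n zero_less_power[of n 3] by linarith
  moreover have "third x U V V = (a\<^sup>2 * b) * third x u h h"
    by (simp add: U_def V_def third_simps[OF x] power2_eq_square)
  ultimately have "(a\<^sup>2 * b) * \<bar>third x u h h\<bar> \<le> (a\<^sup>2 * b) * (4 * a * b\<^sup>2)"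
    using ab by (simp add: abs_mult n_def power2_eq_square power3_eq_cube mult_ac)
  then show ?thesis using ab by (simp add: a_def b_def)
qed

section \<open>Comparison of Hessians and gradients over short steps\<close>

lemma segment_in_interior:
  assumes x: "x \<in> interior K" and u: "local_norm x u < 1" and t: "0 \<le> t" "t \<le> 1"
  shows "x + t *\<^sub>R u \<in> interior K"
proof (rule dikin_ellipsoid[OF x])
  have "t * local_norm x u \<le> local_norm x u" using t x by (intro mult_left_le_one_le) auto
  then show "local_norm x (t *\<^sub>R u) < 1" using u t by (simp add: local_norm_scale)
qed

lemma local_norm_on_segment:
  assumes x: "x \<in> interior K" and u: "local_norm x u < a" "a \<le> 1/25" and t: "0 \<le> t" "t \<le> 1"
  shows "local_norm (x + t *\<^sub>R u) u \<le> 25/24 * a"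
proof -
  have a: "a > 0" using u(1) local_norm_nonneg[OF x, of u] by linarith
  have at: "a * t \<le> 1/25" using t a u(2) by (smt (verit) mult_left_le)
  have "local_norm (x + t *\<^sub>R u) u \<le> a / (1 - a * t)"
    by (rule local_norm_along_line) (use t x u at in \<open>auto intro: segment_in_interior\<close>)
  also have "\<dots> \<le> a / (24/25)" using a at by (intro divide_left_mono) auto
  finally show ?thesis by simp
qed

text \<open>The logarithmic derivative of the form along the segment is at most 4 * 25/24 * 1/25 =
  1/6 in absolute value, and 1/6 <= ln (6/5). Working with the logarithm gives both directions at
  once.\<close>

lemma hessian_compare:
  assumes x: "x \<in> interior K" and u: "local_norm x u < a" "a \<le> 1/25"
  shows "h \<bullet> (H (x + u) *v h) \<le> 6/5 * (h \<bullet> (H x *v h))"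
    and "h \<bullet> (H x *v h) \<le> 6/5 * (h \<bullet> (H (x + u) *v h))"
proof -
  have "h \<bullet> (H (x + u) *v h) \<le> 6/5 * (h \<bullet> (H x *v h)) \<and> h \<bullet> (H x *v h) \<le> 6/5 * (h \<bullet> (H (x + u) *v h))"
  proof (cases "h = 0")
    case False
    have seg: "x + t *\<^sub>R u \<in> interior K" if "0 \<le> t" "t \<le> 1" for t
      using segment_in_interior[OF x _ that] u by simp
    define \<phi> where "\<phi> = (\<lambda>t. h \<bullet> (H (x + t *\<^sub>R u) *v h))"
    define \<phi>' where "\<phi>' = (\<lambda>t. third (x + t *\<^sub>R u) u h h)"
    have pos: "\<phi> t > 0" if "0 \<le> t" "t \<le> 1" for t
      using hessian_pos[OF seg[OF that] False] by (simp add: \<phi>_def)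
    have d: "((\<lambda>t. ln (\<phi> t)) has_real_derivative inverse (\<phi> t) * \<phi>' t) (at t)" if "0 \<le> t" "t \<le> 1" for t
    proof (rule DERIV_chain2[of ln _ \<phi>, OF DERIV_ln[OF pos[OF that]]])
      show "(\<phi> has_real_derivative \<phi>' t) (at t)"
        unfolding \<phi>_def \<phi>'_def by (rule line_derivs(3)[OF seg[OF that]])
    qed
    from MVT2[of 0 1, OF _ d] obtain z where z: "0 < z" "z < 1"
      "ln (\<phi> 1) - ln (\<phi> 0) = inverse (\<phi> z) * \<phi>' z" by auto
    have "\<bar>\<phi>' z\<bar> \<le> 4 * local_norm (x + z *\<^sub>R u) u * (local_norm (x + z *\<^sub>R u) h)\<^sup>2"
      unfolding \<phi>'_def by (rule third_bound[OF seg]) (use z in auto)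
    also have "\<dots> \<le> 4 * (25/24 * a) * (local_norm (x + z *\<^sub>R u) h)\<^sup>2"
      using local_norm_on_segment[OF x u, of z] z by (intro mult_right_mono mult_left_mono) auto
    also have "\<dots> \<le> 1/6 * (local_norm (x + z *\<^sub>R u) h)\<^sup>2"
      using u(2) by (intro mult_right_mono) auto
    also have "\<dots> = 1/6 * \<phi> z" using local_norm_sq[OF seg[of z], of h] z by (simp add: \<phi>_def)
    finally have "\<bar>inverse (\<phi> z) * \<phi>' z\<bar> \<le> 1/6"
      using pos[of z] z by (simp add: abs_mult field_simps)
    moreover have "1/6 \<le> ln (6/5 :: real)"
      using ln_le_minus_one[of "5/6::real"] ln_div[of 5 "6::real"] ln_div[of 6 "5::real"] by simp
    ultimately have "ln (\<phi> 1) \<le> ln (6/5) + ln (\<phi> 0)" "ln (\<phi> 0) \<le> ln (6/5) + ln (\<phi> 1)"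
      using z(3) by linarith+
    then have "ln (\<phi> 1) \<le> ln (6/5 * \<phi> 0)" "ln (\<phi> 0) \<le> ln (6/5 * \<phi> 1)"
      using pos[of 0] pos[of 1] by (simp_all only: ln_mult_pos)
    then show ?thesis using pos[of 0] pos[of 1] by (simp add: \<phi>_def)
  qed simp
  then show "h \<bullet> (H (x + u) *v h) \<le> 6/5 * (h \<bullet> (H x *v h))"
    and "h \<bullet> (H x *v h) \<le> 6/5 * (h \<bullet> (H (x + u) *v h))" by simp_all
qed

lemma local_norm_compare:
  assumes x: "x \<in> interior K" and u: "local_norm x u < a" "a \<le> 1/25"
  shows "local_norm (x + u) h \<le> 11/10 * local_norm x h"
    and "local_norm x h \<le> 11/10 * local_norm (x + u) h"
proof -
  have "x + u \<in> interior K" using dikin_ellipsoid[OF x, of u] u by simp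
  then have nn: "0 \<le> h \<bullet> (H (x + u) *v h)" "0 \<le> h \<bullet> (H x *v h)"
    using hessian_nonneg x by auto
  have s: "sqrt v \<le> 11/10 * sqrt w" if "v \<le> 6/5 * w" "0 \<le> w" for v w :: real
  proof -
    \<comment> \<open>(11/10)^2 = 1.21 exceeds 6/5.\<close>
    have "sqrt v \<le> sqrt ((11/10)\<^sup>2 * w)" using that by (intro real_sqrt_le_mono) (simp add: power2_eq_square)
    then show ?thesis by (simp add: real_sqrt_mult)
  qed
  show "local_norm (x + u) h \<le> 11/10 * local_norm x h" "local_norm x h \<le> 11/10 * local_norm (x + u) h"
    using s[OF hessian_compare(1)[OF x u] nn(2)] s[OF hessian_compare(2)[OF x u] nn(1)]
    by (simp_all add: local_norm_def)
qed

text \<open>Two nested mean values, which give a factor below 1 where Taylor's formula has 1/2. The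
  constant 5 rounds up 4 * 11/10 * (25/24)^2, about 4.77.\<close>

lemma gradient_linearisation_error:
  assumes x: "x \<in> interior K" and u: "local_norm x u < a" "a \<le> 1/25"
  shows "\<bar>(g (x + u) - g x - H x *v u) \<bullet> h\<bar> \<le> 5 * a\<^sup>2 * local_norm x h"
proof -
  have a: "a > 0" using u(1) local_norm_nonneg[OF x, of u] by linarith
  have seg: "x + t *\<^sub>R u \<in> interior K" if "0 \<le> t" "t \<le> 1" for t
    using segment_in_interior[OF x _ that] u by simp
  define \<theta> where "\<theta> = (\<lambda>t. u \<bullet> (H (x + t *\<^sub>R u) *v h))"
  have d1: "((\<lambda>t. g (x + t *\<^sub>R u) \<bullet> h) has_real_derivative \<theta> t) (at t)" if "0 \<le> t" "t \<le> 1" for t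
    unfolding \<theta>_def by (rule line_derivs(2)[OF seg[OF that]])
  from MVT2[of 0 1, OF _ d1] obtain z where z: "0 < z" "z < 1"
    "g (x + u) \<bullet> h - g x \<bullet> h = \<theta> z" by auto
  have d2: "(\<theta> has_real_derivative third (x + t *\<^sub>R u) u u h) (at t)" if "0 \<le> t" "t \<le> z" for t
    unfolding \<theta>_def by (rule line_derivs(3)[OF seg]) (use that z in auto)
  from MVT2[OF z(1) d2] obtain y where y: "0 < y" "y < z"
    "\<theta> z - \<theta> 0 = z * third (x + y *\<^sub>R u) u u h" by auto
  let ?y = "x + y *\<^sub>R u"
  have Y: "?y \<in> interior K" using seg y z by simp
  \<comment> \<open>\<open>third_bound\<close> wants the repeated argument in the last two slots, so
    \<open>h\<close> is moved to the front.\<close>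
  have "\<bar>third ?y u u h\<bar> = \<bar>third ?y h u u\<bar>"
    using third_swap12[OF Y] third_swap23[OF Y] by metis
  also have "\<dots> \<le> 4 * local_norm ?y h * (local_norm ?y u)\<^sup>2" by (rule third_bound[OF Y])
  also have "\<dots> \<le> 4 * (11/10 * local_norm x h) * (25/24 * a)\<^sup>2"
  proof -
    have "local_norm x (y *\<^sub>R u) \<le> local_norm x u"
      using y z x by (simp add: local_norm_scale mult_left_le_one_le)
    then have "local_norm ?y h \<le> 11/10 * local_norm x h"
      by (intro local_norm_compare(1)[OF x _ u(2)]) (use u in auto)
    then show ?thesis
      using local_norm_on_segment[OF x u, of y] y z x Y by (intro mult_mono power_mono) auto
  qed
  also have "\<dots> = (4 * (11/10) * (25/24)\<^sup>2) * (a\<^sup>2 * local_norm x h)"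
    by (simp add: power2_eq_square)
  also have "\<dots> \<le> 5 * (a\<^sup>2 * local_norm x h)"
    using x by (intro mult_right_mono) (auto simp: power2_eq_square)
  finally have "\<bar>third ?y u u h\<bar> \<le> 5 * a\<^sup>2 * local_norm x h" by simp
  moreover have "\<bar>z * third ?y u u h\<bar> \<le> \<bar>third ?y u u h\<bar>"
    using z by (simp add: abs_mult mult_left_le_one_le)
  moreover have "(g (x + u) - g x - H x *v u) \<bullet> h = \<theta> z - \<theta> 0"
    using z(3) hessian_sym[OF x, of h u] by (simp add: inner_diff_right inner_commute[of _ h] \<theta>_def)
  ultimately show ?thesis using y(3) by simp
qed

section \<open>The dual local norm and the neighbourhood\<close>

lemma hessian_inv:
  assumes x: "x \<in> interior K"
  shows "H x *v (matrix_inv (H x) *v v) = v"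
proof -
  have "inj ((*v) (H x))"
  proof (rule injI)
    fix a b assume "H x *v a = H x *v b"
    then have "(a - b) \<bullet> (H x *v (a - b)) = 0" by (simp add: matrix_vector_mult_diff_distrib)
    then show "a = b" using hessian_pos[OF x, of "a - b"] by force
  qed
  then have "invertible (H x)"
    using invertible_left_inverse matrix_left_invertible_injective by blast
  then show ?thesis
    unfolding invertible_def matrix_inv_def matrix_vector_mul_assoc
    by (rule someI2_ex) simp
qed

lemma dual_local_norm_eq:
  assumes x: "x \<in> interior K"
  shows "dual_local_norm F x v = local_norm x (matrix_inv (H x) *v v)"
  by (simp add: dual_local_norm_def local_norm_def hessian_inv[OF x] inner_commute)

lemma dual_local_norm_bound:
  assumes x: "x \<in> interior K"
  shows "\<bar>v \<bullet> h\<bar> \<le> dual_local_norm F x v * local_norm x h"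
  using hessian_cauchy_schwarz[OF x, of h "matrix_inv (H x) *v v"]
  by (simp add: dual_local_norm_eq[OF x] hessian_inv[OF x] inner_commute mult.commute)

text \<open>The converse of \<open>dual_local_norm_bound\<close>: the vector \<open>k\<close>
  representing \<open>v\<close> in the Hessian inner product attains the dual norm, so testing with
  it is enough.\<close>

lemma dual_local_norm_leI:
  assumes x: "x \<in> interior K" and c: "0 \<le> c" and v: "\<And>h. v \<bullet> h \<le> c * local_norm x h"
  shows "dual_local_norm F x v \<le> c"
proof -
  define k where "k = matrix_inv (H x) *v v"
  have "(local_norm x k)\<^sup>2 = v \<bullet> k"
    by (simp add: local_norm_sq[OF x] k_def hessian_inv[OF x] inner_commute)
  then have "local_norm x k * local_norm x k \<le> c * local_norm x k"
    using v[of k] by (simp add: power2_eq_square)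
  then have "local_norm x k \<le> c"
    using c local_norm_nonneg[OF x, of k] by (cases "local_norm x k = 0") auto
  then show ?thesis by (simp add: dual_local_norm_eq[OF x] k_def)
qed

text \<open>For \<open>u\<close> in the cone, s.u = \<psi>.u - \<mu> g.u, where the first term is at
  least -\<mu> times the local norm of \<open>u\<close> and the second is at least \<mu> times it by
  \<open>local_norm_le_neg_gradient\<close>.\<close>

lemma in_interior_dual_cone:
  assumes x: "x \<in> interior K" and \<mu>: "dual_local_norm F x (psi F x s \<mu>) < \<mu>"
  shows "s \<in> interior (dual_cone K)"
proof (rule interiorI)
  \<comment> \<open>\<mu> stays fixed while \<open>s\<close> varies, so the strict inequality
    defines an open set.\<close>
  let ?S = "{s. dual_local_norm F x (psi F x s \<mu>) < \<mu>}"
  show "open ?S"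
    unfolding dual_local_norm_def psi_def
    by (intro open_Collect_less continuous_intros continuous_on_inner
        bounded_linear.continuous_on[OF matrix_vector_mul_bounded_linear])
  show "s \<in> ?S" using \<mu> by simp
  show "?S \<subseteq> dual_cone K"
  proof
    fix s assume "s \<in> ?S"
    then have s: "dual_local_norm F x (psi F x s \<mu>) \<le> \<mu>" by simp
    have \<mu>0: "0 \<le> \<mu>" using s x by (simp add: dual_local_norm_eq order_trans[OF local_norm_nonneg])
    have "0 \<le> s \<bullet> u" if u: "u \<in> K" for u
    proof -
      have "\<bar>psi F x s \<mu> \<bullet> u\<bar> \<le> \<mu> * local_norm x u"
        using dual_local_norm_bound[OF x, of "psi F x s \<mu>" u] mult_right_mono[OF s local_norm_nonneg[OF x, of u]]
        by linarith
      moreover have "\<mu> * local_norm x u \<le> \<mu> * - (g x \<bullet> u)"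
        using local_norm_le_neg_gradient[OF x u] \<mu>0 by (rule mult_left_mono)
      moreover have "psi F x s \<mu> \<bullet> u = s \<bullet> u + \<mu> * (g x \<bullet> u)" by (simp add: psi_def inner_add_left)
      ultimately show ?thesis by (simp add: abs_le_iff)
    qed
    then show "s \<in> dual_cone K" by (simp add: dual_cone_def)
  qed
qed

lemma interior_feasible:
  "interior (feasible K :: ('n, 'm::finite) point set)
    = (interior K \<times> {0<..}) \<times> UNIV \<times> (interior (dual_cone K) \<times> {0<..})"
  by (simp add: feasible_def interior_Times)

lemma nbhdD:
  fixes y :: "real^'m"
  assumes "((x, \<tau>), y, (s, \<kappa>)) \<in> nbhd K F \<nu> \<eta> \<beta>\<^sub>l \<beta>\<^sub>u" "0 < \<beta>\<^sub>u"
  shows "x \<in> interior K" "0 < \<tau>" "0 < \<kappa>" "0 < compl_gap \<nu> x s"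
    "dual_local_norm F x (psi F x s (compl_gap \<nu> x s)) \<le> \<eta> * compl_gap \<nu> x s"
    "\<beta>\<^sub>l * compl_gap \<nu> x s \<le> \<kappa> * \<tau>" "\<kappa> * \<tau> \<le> \<beta>\<^sub>u * compl_gap \<nu> x s"
proof -
  show *: "x \<in> interior K" "0 < \<tau>" "0 < \<kappa>"
    "dual_local_norm F x (psi F x s (compl_gap \<nu> x s)) \<le> \<eta> * compl_gap \<nu> x s"
    "\<beta>\<^sub>l * compl_gap \<nu> x s \<le> \<kappa> * \<tau>" "\<kappa> * \<tau> \<le> \<beta>\<^sub>u * compl_gap \<nu> x s"
    using assms by (auto simp: nbhd_def interior_feasible)
  have "0 < \<beta>\<^sub>u * compl_gap \<nu> x s" using *(2,3,6) by (smt (verit) mult_pos_pos)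
  then show "0 < compl_gap \<nu> x s" using assms(2) by (simp add: zero_less_mult_iff)
qed

text \<open>Proximity with \<open>\<eta> < 1\<close> already places \<open>s\<close> in the interior
  of the dual cone, so a step only has to establish interiority of \<open>x\<close> and positivity
  of \<tau>, \<kappa> and the gap.\<close>

lemma nbhdI:
  fixes y :: "real^'m"
  assumes "x \<in> interior K" "0 < \<tau>" "0 < \<kappa>" "0 < compl_gap \<nu> x s" "\<eta> < 1"
    "dual_local_norm F x (psi F x s (compl_gap \<nu> x s)) \<le> \<eta> * compl_gap \<nu> x s"
    "\<beta>\<^sub>l * compl_gap \<nu> x s \<le> \<kappa> * \<tau>" "\<kappa> * \<tau> \<le> \<beta>\<^sub>u * compl_gap \<nu> x s"
  shows "((x, \<tau>), y, (s, \<kappa>)) \<in> nbhd K F \<nu> \<eta> \<beta>\<^sub>l \<beta>\<^sub>u"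
proof -
  have "\<eta> * compl_gap \<nu> x s < compl_gap \<nu> x s" using assms(4,5) by simp
  then have "s \<in> interior (dual_cone K)"
    using assms(6) by (intro in_interior_dual_cone[OF assms(1), of s "compl_gap \<nu> x s"]) linarith
  then show ?thesis using assms by (simp add: nbhd_def interior_feasible)
qed

end

section \<open>The Newton systems\<close>

lemma outer_mult_vec: "outer v *v u = (v \<bullet> u) *\<^sub>R v"
  by (simp add: outer_def matrix_vector_mult_def inner_vec_def vec_eq_iff sum_distrib_right sum_distrib_left mult_ac)

lemma inner_scaling:
  "h \<bullet> (scaling F \<nu> x s *v u) = h \<bullet> (hessian F x *v u)
     + (s \<bullet> h) * (s \<bullet> u) / (\<nu> * (compl_gap \<nu> x s)\<^sup>2) - (gradient F x \<bullet> h) * (gradient F x \<bullet> u) / \<nu>"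
  by (simp add: scaling_def matrix_vector_mult_add_rdistrib matrix_vector_mult_diff_rdistrib
      scaleR_matrix_vector_assoc[symmetric] outer_mult_vec inner_simps inner_commute[of h s] inner_commute[of h "gradient F x"] mult.commute)

lemma G_map_skew:
  fixes A :: "real^'n^'m"
  shows "(dy \<bullet> fst (G_map A b c (dy, (dx, d\<tau>)))) + dx \<bullet> fst (snd (G_map A b c (dy, (dx, d\<tau>))))
     + d\<tau> * snd (snd (G_map A b c (dy, (dx, d\<tau>)))) = 0"
proof -
  have "dx \<bullet> (transpose A *v dy) = dy \<bullet> (A *v dx)"
    by (metis dot_lmul_matrix inner_commute transpose_matrix_vector)
  then show ?thesis
    by (simp add: G_map_def inner_simps inner_commute algebra_simps)
qed

text \<open>The common left-hand side of the predictor and the corrector system, with the two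
  complementarity equations first so that it is an endomorphism of the space of points.\<close>

definition newton_map :: "real^'n^'m \<Rightarrow> real^'m \<Rightarrow> real^'n \<Rightarrow> real \<Rightarrow> real \<Rightarrow> real^'n^'n \<Rightarrow> ('n, 'm) point \<Rightarrow> ('n, 'm) point" where
  "newton_map A b c \<tau> \<kappa> M = (\<lambda>((dx, d\<tau>), dy, (ds, d\<kappa>)).
     ((ds + M *v dx, \<tau> * d\<kappa> + \<kappa> * d\<tau>), G_map A b c (dy, (dx, d\<tau>)) - (0, (ds, d\<kappa>))))"

lemma linear_newton_map: "linear (newton_map A b c \<tau> \<kappa> M)"
  by (rule linearI)
     (auto simp: newton_map_def G_map_def matrix_vector_right_distrib matrix_vector_mult_scaleR
       inner_simps algebra_simps simp del: transpose_matrix_vector)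

text \<open>For a vector of the kernel, skew-symmetry leaves dx.(M dx) + (\<kappa>/\<tau>) d\<tau>^2
  = 0, hence every component but \<open>dy\<close> vanishes. Full row rank makes the transpose of
  \<open>A\<close> injective and removes \<open>dy\<close>; finite dimension does the rest.\<close>

lemma bij_newton_map:
  fixes A :: "real^'n^'m"
  assumes A: "rank A = CARD('m)" and pos: "0 < \<tau>" "0 < \<kappa>"
    and M: "\<And>u. u \<noteq> 0 \<Longrightarrow> 0 < u \<bullet> (M *v u)"
  shows "bij (newton_map A b c \<tau> \<kappa> M)"
proof -
  have "inj (newton_map A b c \<tau> \<kappa> M)"
    unfolding linear_injective_0[OF linear_newton_map]
  proof (intro allI impI)
    fix dz :: "('n, 'm) point"
    obtain dx d\<tau> dy ds d\<kappa> where dz: "dz = ((dx, d\<tau>), dy, (ds, d\<kappa>))" by (metis prod.exhaust)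
    assume "newton_map A b c \<tau> \<kappa> M dz = 0"
    then have "fst (newton_map A b c \<tau> \<kappa> M dz) = 0" "snd (newton_map A b c \<tau> \<kappa> M dz) = 0" by simp_all
    then have eq: "ds = - (M *v dx)" "\<tau> * d\<kappa> + \<kappa> * d\<tau> = 0"
      "G_map A b c (dy, (dx, d\<tau>)) = (0, (ds, d\<kappa>))"
      by (simp_all add: newton_map_def dz prod_eq_iff eq_neg_iff_add_eq_0)
    have "dx \<bullet> ds + d\<tau> * d\<kappa> = 0" using G_map_skew[of dy A b c dx d\<tau>] by (simp add: eq(3))
    moreover have d\<kappa>: "d\<kappa> = - (\<kappa> / \<tau>) * d\<tau>" using eq(2) pos by (simp add: field_simps add_eq_0_iff)
    ultimately have sum: "dx \<bullet> (M *v dx) + (\<kappa> / \<tau>) * (d\<tau> * d\<tau>) = 0"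
      by (simp add: eq(1) algebra_simps)
    have nonneg: "0 \<le> (\<kappa> / \<tau>) * (d\<tau> * d\<tau>)" using pos by simp
    have dx: "dx = 0" using sum nonneg M[of dx] by fastforce
    then have d\<tau>: "d\<tau> = 0" using sum pos by simp
    have "ds = 0" "d\<kappa> = 0" using eq(1) d\<kappa> dx d\<tau> by simp_all
    then have "transpose A *v dy = 0" using eq(3) dx d\<tau> by (simp add: G_map_def)
    moreover have "inj ((*v) (transpose A))" using A by (simp add: rank_transpose flip: full_rank_injective)
    ultimately have "dy = 0" by (metis injD matrix_vector_mult_0_right)
    then show "dz = 0" using dx d\<tau> \<open>ds = 0\<close> \<open>d\<kappa> = 0\<close> by (simp add: dz zero_prod_def)
  qed
  then show ?thesis
    using linear_injective_imp_surjective[OF linear_newton_map] by (simp add: bij_def)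
qed

lemma predictor_directionI:
  fixes A :: "real^'n^'m"
  assumes "bij (newton_map A b c \<tau> \<kappa> (compl_gap \<nu> x s *\<^sub>R scaling F \<nu> x s))"
  shows "predictor_system F \<nu> A b c ((x, \<tau>), y, (s, \<kappa>)) (predictor_direction F \<nu> A b c ((x, \<tau>), y, (s, \<kappa>)))"
  unfolding predictor_direction_def
proof (rule theI')
  have *: "predictor_system F \<nu> A b c ((x, \<tau>), y, (s, \<kappa>)) dz \<longleftrightarrow>
      newton_map A b c \<tau> \<kappa> (compl_gap \<nu> x s *\<^sub>R scaling F \<nu> x s) dz
        = ((- s, - (\<kappa> * \<tau>)), - residual A b c ((x, \<tau>), y, (s, \<kappa>)))" for dz
    by (auto simp: predictor_system_def newton_map_def scaleR_matrix_vector_assoc split: prod.splits)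
  show "\<exists>!dz. predictor_system F \<nu> A b c ((x, \<tau>), y, (s, \<kappa>)) dz"
    unfolding * by (rule spec[OF iffD1[OF bij_iff assms]])
qed

lemma corrector_directionI:
  fixes A :: "real^'n^'m"
  assumes "bij (newton_map A b c \<tau> \<kappa> (compl_gap \<nu> x s *\<^sub>R scaling F \<nu> x s))"
  shows "corrector_system F \<nu> A b c \<sigma> ((x, \<tau>), y, (s, \<kappa>)) (corrector_direction F \<nu> A b c \<sigma> ((x, \<tau>), y, (s, \<kappa>)))"
  unfolding corrector_direction_def
proof (rule theI')
  have *: "corrector_system F \<nu> A b c \<sigma> ((x, \<tau>), y, (s, \<kappa>)) dz \<longleftrightarrow>
      newton_map A b c \<tau> \<kappa> (compl_gap \<nu> x s *\<^sub>R scaling F \<nu> x s) dz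
        = ((- psi F x s (compl_gap \<nu> x s), \<sigma> * compl_gap \<nu> x s - \<kappa> * \<tau>), 0)" for dz
    by (auto simp: corrector_system_def newton_map_def scaleR_matrix_vector_assoc split: prod.splits)
  show "\<exists>!dz. corrector_system F \<nu> A b c \<sigma> ((x, \<tau>), y, (s, \<kappa>)) dz"
    unfolding * by (rule spec[OF iffD1[OF bij_iff assms]])
qed

text \<open>The full Newton step has residual zero, so the skew form is applied to the point reached
  by the full step rather than to the direction.\<close>

lemma predictor_system_orthogonal:
  fixes A :: "real^'n^'m"
  assumes "predictor_system F \<nu> A b c ((x, \<tau>), y, (s, \<kappa>)) ((dx, d\<tau>), dy, (ds, d\<kappa>))"
  shows "(x + dx) \<bullet> (s + ds) + (\<tau> + d\<tau>) * (\<kappa> + d\<kappa>) = 0"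
proof -
  have "G_map A b c (y + dy, (x + dx, \<tau> + d\<tau>)) = G_map A b c (y, (x, \<tau>)) + G_map A b c (dy, (dx, d\<tau>))"
    by (simp add: G_map_def matrix_vector_right_distrib inner_simps algebra_simps)
  also have "\<dots> = (0, (s + ds, \<kappa> + d\<kappa>))"
    using assms by (auto simp: predictor_system_def residual_def prod_eq_iff algebra_simps)
  finally show ?thesis using G_map_skew[of "y + dy" A b c "x + dx" "\<tau> + d\<tau>"] by simp
qed

lemma corrector_system_orthogonal:
  fixes A :: "real^'n^'m"
  assumes "corrector_system F \<nu> A b c \<sigma> ((x, \<tau>), y, (s, \<kappa>)) ((dx, d\<tau>), dy, (ds, d\<kappa>))"
  shows "dx \<bullet> ds + d\<tau> * d\<kappa> = 0"
  using assms G_map_skew[of dy A b c dx d\<tau>] by (simp add: corrector_system_def)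

context lhscb_cone
begin

section \<open>The scaling matrix and the proximity after a step\<close>

lemma sqrt_nu_le: "sqrt \<nu> \<le> \<nu>"
  using nu_ge_1 mult_left_mono[of 1 "sqrt \<nu>" "sqrt \<nu>"] by simp

lemma abs_divide_nu_le: "\<bar>r / \<nu>\<bar> * sqrt \<nu> \<le> \<bar>r\<bar>" "\<bar>r / \<nu>\<bar> \<le> \<bar>r\<bar>"
  using nu_ge_1 mult_left_mono[OF sqrt_nu_le, of "\<bar>r\<bar>"] mult_left_mono[OF nu_ge_1, of "\<bar>r\<bar>"]
  by (simp_all add: field_simps)

text \<open>With p = \<psi> / \<mu> one has s = \<mu> (p - g), so the g g terms of the two rank-one
  corrections cancel. What remains has size (\<eta>^2 + 2 \<eta> sqrt \<nu>) / \<nu>, and \<nu> >= 1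
  makes it independent of \<nu>.\<close>

lemma scaling_close_to_hessian:
  assumes x: "x \<in> interior K" and \<mu>: "\<mu> = compl_gap \<nu> x s" "0 < \<mu>"
    and \<eta>: "0 \<le> \<eta>" "dual_local_norm F x (psi F x s \<mu>) \<le> \<eta> * \<mu>"
  shows "\<bar>h \<bullet> (scaling F \<nu> x s *v u) - h \<bullet> (H x *v u)\<bar> \<le> (\<eta>\<^sup>2 + 2 * \<eta>) * local_norm x h * local_norm x u"
proof -
  define p where "p = (\<lambda>h. (psi F x s \<mu> \<bullet> h) / \<mu>)"
  have p: "\<bar>p h\<bar> \<le> \<eta> * local_norm x h" for h
  proof -
    have "\<bar>psi F x s \<mu> \<bullet> h\<bar> \<le> \<eta> * \<mu> * local_norm x h"
      using dual_local_norm_bound[OF x, of "psi F x s \<mu>" h]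
        mult_right_mono[OF \<eta>(2) local_norm_nonneg[OF x, of h]] by linarith
    then show ?thesis using \<mu>(2) by (simp add: p_def field_simps)
  qed
  have s: "s \<bullet> h = \<mu> * (p h - g x \<bullet> h)" for h
    using \<mu>(2) by (simp add: p_def psi_def inner_add_left field_simps)
  note \<nu> = nu_ge_1
  let ?a = "local_norm x h" and ?b = "local_norm x u"
  have ab: "0 \<le> ?a" "0 \<le> ?b" using x by simp_all
  have "h \<bullet> (scaling F \<nu> x s *v u) - h \<bullet> (H x *v u)
      = (s \<bullet> h) * (s \<bullet> u) / (\<nu> * \<mu>\<^sup>2) - (g x \<bullet> h) * (g x \<bullet> u) / \<nu>"
    by (simp add: inner_scaling flip: \<mu>(1))
  also have "\<dots> = (p h * p u - p h * (g x \<bullet> u) - (g x \<bullet> h) * p u) / \<nu>"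
    unfolding s using \<mu>(2) \<nu> by (simp add: field_simps power2_eq_square)
  finally have eq: "h \<bullet> (scaling F \<nu> x s *v u) - h \<bullet> (H x *v u)
      = (p h * p u - p h * (g x \<bullet> u) - (g x \<bullet> h) * p u) / \<nu>" .
  have "\<bar>p h * p u\<bar> \<le> (\<eta> * ?a) * (\<eta> * ?b)"
    unfolding abs_mult by (intro mult_mono p) (use \<eta> ab in auto)
  moreover have "\<bar>p h * (g x \<bullet> u)\<bar> \<le> (\<eta> * ?a) * (sqrt \<nu> * ?b)"
    unfolding abs_mult by (intro mult_mono p abs_gradient_le x) (use \<eta> ab in auto)
  moreover have "\<bar>(g x \<bullet> h) * p u\<bar> \<le> (sqrt \<nu> * ?a) * (\<eta> * ?b)"
    unfolding abs_mult by (intro mult_mono p abs_gradient_le x) (use \<eta> ab nu_pos in auto)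
  ultimately have "\<bar>p h * p u - p h * (g x \<bullet> u) - (g x \<bullet> h) * p u\<bar>
      \<le> (\<eta> * ?a) * (\<eta> * ?b) + (\<eta> * ?a) * (sqrt \<nu> * ?b) + (sqrt \<nu> * ?a) * (\<eta> * ?b)" by linarith
  also have "\<dots> = (\<eta>\<^sup>2 + 2 * \<eta> * sqrt \<nu>) * (?a * ?b)" by (simp add: algebra_simps power2_eq_square)
  also have "\<dots> \<le> ((\<eta>\<^sup>2 + 2 * \<eta>) * \<nu>) * (?a * ?b)"
  proof (intro mult_right_mono)
    have "2 * \<eta> * sqrt \<nu> \<le> 2 * \<eta> * \<nu>" using \<eta> sqrt_nu_le by (intro mult_left_mono) auto
    moreover have "\<eta>\<^sup>2 * 1 \<le> \<eta>\<^sup>2 * \<nu>" using \<nu> by (intro mult_left_mono) auto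
    ultimately show "\<eta>\<^sup>2 + 2 * \<eta> * sqrt \<nu> \<le> (\<eta>\<^sup>2 + 2 * \<eta>) * \<nu>" by (simp add: algebra_simps)
  qed (use ab in auto)
  finally have "\<bar>p h * p u - p h * (g x \<bullet> u) - (g x \<bullet> h) * p u\<bar> / \<nu> \<le> (\<eta>\<^sup>2 + 2 * \<eta>) * (?a * ?b)"
    using \<nu> by (simp add: field_simps)
  then show ?thesis unfolding eq using nu_pos by (simp add: mult.assoc)
qed

text \<open>H x = - g, and the rank-one terms contribute s / \<mu> + g, because s.x = \<nu> \<mu>
  and g.x = - \<nu>.\<close>

lemma inner_scaling_self:
  assumes x: "x \<in> interior K" and \<mu>: "\<mu> = compl_gap \<nu> x s" "0 < \<mu>"
  shows "\<mu> * (h \<bullet> (scaling F \<nu> x s *v x)) = s \<bullet> h" "\<mu> * (x \<bullet> (scaling F \<nu> x s *v h)) = s \<bullet> h"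
proof -
  have sx: "s \<bullet> x = \<nu> * \<mu>" "x \<bullet> s = \<nu> * \<mu>"
    using nu_pos by (simp_all add: \<mu>(1) compl_gap_def inner_commute)
  show "\<mu> * (h \<bullet> (scaling F \<nu> x s *v x)) = s \<bullet> h" "\<mu> * (x \<bullet> (scaling F \<nu> x s *v h)) = s \<bullet> h"
    using \<mu>(2) nu_pos
    by (simp_all add: inner_scaling hessian_self[OF x] gradient_inner_self[OF x] sx power2_eq_square
        flip: \<mu>(1))
qed

text \<open>Both steps have this form: with \<open>\<psi> = s + \<mu> g\<close>, the new proximity vector is
  \<open>c \<psi> - \<mu> (W - H) d + (\<mu>' - m) g + (\<mu>' - \<mu>) H d + \<mu>' e\<close>, where \<open>e\<close> is the error of
  linearising the gradient.\<close>

lemma proximity_after_step: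
  assumes x: "x \<in> interior K" and \<mu>: "\<mu> = compl_gap \<nu> x s" "0 < \<mu>"
    and \<eta>: "0 \<le> \<eta>" "dual_local_norm F x (psi F x s \<mu>) \<le> \<eta> * \<mu>"
    and d: "local_norm x d < a" "a \<le> 1/25" and c: "0 \<le> c" and \<mu>': "0 \<le> \<mu>'"
    and s': "s' = c *\<^sub>R psi F x s \<mu> - m *\<^sub>R g x - \<mu> *\<^sub>R (scaling F \<nu> x s *v d)"
  shows "dual_local_norm F (x + d) (psi F (x + d) s' \<mu>')
    \<le> 11/10 * (c * \<eta> * \<mu> + \<mu> * (\<eta>\<^sup>2 + 2 * \<eta>) * a + \<bar>\<mu>' - m\<bar> * sqrt \<nu> + \<bar>\<mu>' - \<mu>\<bar> * a + \<mu>' * (5 * a\<^sup>2))"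
    (is "_ \<le> 11/10 * ?B")
proof (rule dual_local_norm_leI)
  have a: "a > 0" using d(1) local_norm_nonneg[OF x, of d] by linarith
  show xd: "x + d \<in> interior K" using dikin_ellipsoid[OF x, of d] d by simp
  have B: "0 \<le> ?B" using c \<eta> \<mu> \<mu>' a nu_pos by (intro add_nonneg_nonneg mult_nonneg_nonneg) auto
  then show "0 \<le> 11/10 * ?B" by simp
  fix h
  let ?n = "local_norm x h" and ?W = "scaling F \<nu> x s"
  have n: "0 \<le> ?n" using x by simp
  have 1: "\<bar>psi F x s \<mu> \<bullet> h\<bar> \<le> \<eta> * \<mu> * ?n"
    using dual_local_norm_bound[OF x, of "psi F x s \<mu>" h] mult_right_mono[OF \<eta>(2) n] by linarith
  have 2: "\<bar>h \<bullet> (?W *v d) - h \<bullet> (H x *v d)\<bar> \<le> (\<eta>\<^sup>2 + 2 * \<eta>) * a * ?n"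
  proof -
    have "(\<eta>\<^sup>2 + 2 * \<eta>) * ?n * local_norm x d \<le> (\<eta>\<^sup>2 + 2 * \<eta>) * ?n * a"
      using d \<eta> n by (intro mult_left_mono) auto
    then show ?thesis using scaling_close_to_hessian[OF x \<mu> \<eta>, of h d] by (simp add: mult_ac)
  qed
  have 3: "\<bar>h \<bullet> (H x *v d)\<bar> \<le> a * ?n"
    using hessian_cauchy_schwarz[OF x, of h d] mult_right_mono[OF less_imp_le[OF d(1)] n]
    by (simp add: mult.commute)
  have 4: "\<bar>(g (x + d) - g x - H x *v d) \<bullet> h\<bar> \<le> 5 * a\<^sup>2 * ?n"
    by (rule gradient_linearisation_error[OF x d])
  have "psi F (x + d) s' \<mu>' \<bullet> h = c * (psi F x s \<mu> \<bullet> h) - \<mu> * (h \<bullet> (?W *v d) - h \<bullet> (H x *v d))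
      + (\<mu>' - m) * (g x \<bullet> h) + (\<mu>' - \<mu>) * (h \<bullet> (H x *v d)) + \<mu>' * ((g (x + d) - g x - H x *v d) \<bullet> h)"
    unfolding psi_def[of F "x + d"] s' by (simp add: inner_simps inner_commute[of h] algebra_simps)
  also have "\<dots> \<le> c * (\<eta> * \<mu> * ?n) + \<mu> * ((\<eta>\<^sup>2 + 2 * \<eta>) * a * ?n) + \<bar>\<mu>' - m\<bar> * (sqrt \<nu> * ?n)
      + \<bar>\<mu>' - \<mu>\<bar> * (a * ?n) + \<mu>' * (5 * a\<^sup>2 * ?n)"
  proof -
    have le: "r * v \<le> \<bar>r\<bar> * w" if "\<bar>v\<bar> \<le> w" for r v w :: real
      using mult_left_mono[OF that, of "\<bar>r\<bar>"] abs_ge_self[of "r * v"] by (simp add: abs_mult)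
    have "c * (psi F x s \<mu> \<bullet> h) \<le> c * (\<eta> * \<mu> * ?n)" using le[OF 1, of c] c by simp
    moreover have "- \<mu> * (h \<bullet> (?W *v d) - h \<bullet> (H x *v d)) \<le> \<mu> * ((\<eta>\<^sup>2 + 2 * \<eta>) * a * ?n)"
      using le[OF 2, of "- \<mu>"] \<mu>(2) by simp
    moreover have "\<mu>' * ((g (x + d) - g x - H x *v d) \<bullet> h) \<le> \<mu>' * (5 * a\<^sup>2 * ?n)"
      using le[OF 4, of \<mu>'] \<mu>' by simp
    ultimately show ?thesis
      using le[OF abs_gradient_le[OF x], of "\<mu>' - m" h] le[OF 3, of "\<mu>' - \<mu>"] by linarith
  qed
  also have "\<dots> = ?B * ?n" by (simp add: algebra_simps)
  \<comment> \<open>All terms were measured at \<open>x\<close>; passing to the norm at the new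
    point costs the factor 11/10.\<close>
  also have "\<dots> \<le> ?B * (11/10 * local_norm (x + d) h)"
    using local_norm_compare(2)[OF x d] B by (rule mult_left_mono)
  finally show "psi F (x + d) s' \<mu>' \<bullet> h \<le> 11/10 * ?B * local_norm (x + d) h" by (simp only: mult_ac)
qed

lemma scaling_lower_bound:
  assumes x: "x \<in> interior K" and \<mu>: "\<mu> = compl_gap \<nu> x s" "0 < \<mu>"
    and \<eta>: "0 \<le> \<eta>" "dual_local_norm F x (psi F x s \<mu>) \<le> \<eta> * \<mu>"
  shows "(1 - (\<eta>\<^sup>2 + 2 * \<eta>)) * (local_norm x u)\<^sup>2 \<le> u \<bullet> (scaling F \<nu> x s *v u)"
  using scaling_close_to_hessian[OF assms, of u u]
  by (simp add: local_norm_sq[OF x, symmetric] power2_eq_square algebra_simps abs_le_iff)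

lemma scaling_pos:
  assumes x: "x \<in> interior K" and \<mu>: "\<mu> = compl_gap \<nu> x s" "0 < \<mu>"
    and \<eta>: "0 \<le> \<eta>" "dual_local_norm F x (psi F x s \<mu>) \<le> \<eta> * \<mu>" "\<eta>\<^sup>2 + 2 * \<eta> < 1" and u: "u \<noteq> 0"
  shows "0 < u \<bullet> (scaling F \<nu> x s *v u)"
proof -
  have "0 < (1 - (\<eta>\<^sup>2 + 2 * \<eta>)) * (local_norm x u)\<^sup>2"
    using \<eta>(3) local_norm_pos[OF x u] by (intro mult_pos_pos) auto
  then show ?thesis using scaling_lower_bound[OF x \<mu> \<eta>(1,2), of u] by linarith
qed

lemma bij_newton_map_scaling:
  fixes A :: "real^'n^'m"
  assumes A: "rank A = CARD('m)" and pos: "0 < \<tau>" "0 < \<kappa>"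
    and x: "x \<in> interior K" and \<mu>: "0 < compl_gap \<nu> x s"
    and \<eta>: "0 \<le> \<eta>" "dual_local_norm F x (psi F x s (compl_gap \<nu> x s)) \<le> \<eta> * compl_gap \<nu> x s" "\<eta>\<^sup>2 + 2 * \<eta> < 1"
  shows "bij (newton_map A b c \<tau> \<kappa> (compl_gap \<nu> x s *\<^sub>R scaling F \<nu> x s))"
  using \<mu> scaling_pos[OF x refl \<mu> \<eta>]
  by (intro bij_newton_map A pos) (simp flip: scaleR_matrix_vector_assoc)

section \<open>The predictor and the corrector step\<close>

text \<open>The condition on the step length is \<omega>^2 (1 - \<delta>) on the right and \<nu>
  plus half the upper centrality constant on the left; the latter bounds \<open>q\<close>, the
  squared W-length of \<open>dx\<close>.\<close>

lemma predictor_point_in_nbhd: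
  fixes y' :: "real^'m"
  assumes \<mu>eq: "\<mu> = compl_gap \<nu> x s" and x: "x \<in> interior K" and pos: "0 < \<tau>" "0 < \<kappa>" "0 < \<mu>"
    and prox: "dual_local_norm F x (psi F x s \<mu>) \<le> 0.02 * \<mu>"
    and \<beta>: "0.9 * \<mu> \<le> \<kappa> * \<tau>" "\<kappa> * \<tau> \<le> 0.905 * \<mu>"
    and \<alpha>: "0 < \<alpha>" "\<alpha>\<^sup>2 * (\<nu> + 0.4525) \<le> 0.000025 * 0.9596"
    and ds: "ds + \<mu> *\<^sub>R (scaling F \<nu> x s *v dx) = - s"
    and d\<tau>: "\<tau> * d\<kappa> + \<kappa> * d\<tau> = - (\<kappa> * \<tau>)"
    and orth: "(x + dx) \<bullet> (s + ds) + (\<tau> + d\<tau>) * (\<kappa> + d\<kappa>) = 0"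
  shows "((x + \<alpha> *\<^sub>R dx, \<tau> + \<alpha> * d\<tau>), y', (s + \<alpha> *\<^sub>R ds, \<kappa> + \<alpha> * d\<kappa>)) \<in> nbhd K F \<nu> 0.03518 0.89995 0.90503"
proof -
  note \<mu> = \<mu>eq pos(3)
  note \<nu> = nu_ge_1
  let ?W = "scaling F \<nu> x s"
  define t where "t = d\<tau> / \<tau>"
  define B where "B = \<kappa> * \<tau> / \<mu>"
  have B: "\<kappa> * \<tau> = B * \<mu>" "0.9 \<le> B" "B \<le> 0.905"
    using \<beta> pos by (simp_all add: B_def field_simps)
  have dt: "d\<tau> = \<tau> * t" "d\<kappa> = - \<kappa> - \<kappa> * t"
  proof -
    show *: "d\<tau> = \<tau> * t" using pos by (simp add: t_def)
    have "\<tau> * (d\<kappa> - (- \<kappa> - \<kappa> * t)) = 0" using d\<tau> unfolding * by (simp add: algebra_simps)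
    then show "d\<kappa> = - \<kappa> - \<kappa> * t" using pos by simp
  qed
  have ds': "ds = - s - \<mu> *\<^sub>R (?W *v dx)" using ds by (simp add: algebra_simps eq_neg_iff_add_eq_0)
  define e q where "e = x \<bullet> (?W *v dx)" and "q = dx \<bullet> (?W *v dx)"
  have sdx: "s \<bullet> dx = \<mu> * e" "dx \<bullet> s = \<mu> * e" "dx \<bullet> (?W *v x) = e"
  proof -
    note W = inner_scaling_self[OF x \<mu>, of dx]
    show "s \<bullet> dx = \<mu> * e" "dx \<bullet> s = \<mu> * e" using W(2) by (simp_all add: e_def inner_commute)
    have "\<mu> * (dx \<bullet> (?W *v x)) = \<mu> * e" using W by (simp add: e_def)
    then show "dx \<bullet> (?W *v x) = e" using pos(3) by simp
  qed
  have xs: "x \<bullet> s = \<nu> * \<mu>" using \<nu> by (simp add: \<mu>eq compl_gap_def)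
  have xWx: "x \<bullet> (?W *v x) = \<nu>"
    using inner_scaling_self(1)[OF x \<mu>, of x] pos(3) xs by (simp add: inner_commute)
  have Wnn: "0 \<le> v \<bullet> (?W *v v)" for v
    using scaling_pos[OF x \<mu>, of "0.02" v] prox by (cases "v = 0") (auto simp: power2_eq_square intro: less_imp_le)
  \<comment> \<open>The W-form at dx + r x. The value r = 1 bounds \<open>q\<close>, and r = 1/2
    bounds \<zeta>.\<close>
  have sq: "0 \<le> q + 2 * r * e + r\<^sup>2 * \<nu>" for r
  proof -
    have "(dx + r *\<^sub>R x) \<bullet> (?W *v (dx + r *\<^sub>R x)) = q + 2 * r * e + r\<^sup>2 * \<nu>"
      by (simp add: matrix_vector_right_distrib matrix_vector_mult_scaleR inner_simps sdx(3) xWx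
          power2_eq_square distrib_left mult.commute flip: q_def e_def)
    then show ?thesis using Wnn[of "dx + r *\<^sub>R x"] by simp
  qed
  \<comment> \<open>This is -(\<tau> + d\<tau>)(\<kappa> + d\<kappa>) / \<mu>; as a quadratic in
    \<open>t\<close> it is at least -B/4, the source of the constant 0.4525.\<close>
  define \<zeta> where "\<zeta> = B * (t + t\<^sup>2)"
  have qe: "q + e = - \<zeta>"
  proof -
    have "(x + dx) \<bullet> (s + ds) = - \<mu> * (e + q)"
      by (simp add: ds' inner_simps e_def q_def algebra_simps)
    moreover have "(\<tau> + d\<tau>) * (\<kappa> + d\<kappa>) = - (\<kappa> * \<tau>) * (t + t\<^sup>2)"
      by (simp add: dt algebra_simps power2_eq_square)
    ultimately have "\<mu> * (e + q + \<zeta>) = 0" using orth by (simp add: B \<zeta>_def algebra_simps)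
    then show ?thesis using pos by simp
  qed
  have \<zeta>: "- 0.25 * B \<le> \<zeta>" "\<zeta> \<le> \<nu> / 4"
  proof -
    have "0 \<le> B * (t + 1/2)\<^sup>2" using B by simp
    then show "- 0.25 * B \<le> \<zeta>" by (simp add: \<zeta>_def power2_eq_square algebra_simps)
    show "\<zeta> \<le> \<nu> / 4" using sq[of "1/2"] qe by (simp add: power2_eq_square)
  qed
  have q: "q \<le> \<nu> + 0.4525" using sq[of 1] qe \<zeta>(1) B(3) by simp
  have \<alpha>2: "\<alpha>\<^sup>2 * \<nu> \<le> 0.000025" "\<alpha>\<^sup>2 \<le> 0.000025"
  proof -
    have "\<alpha>\<^sup>2 * \<nu> + 181/400 * \<alpha>\<^sup>2 \<le> 1/40000" using \<alpha>(2) by (simp add: algebra_simps)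
    moreover have "0 \<le> \<alpha>\<^sup>2" by simp
    ultimately have "\<alpha>\<^sup>2 * \<nu> \<le> 1/40000" by linarith
    then show 1: "\<alpha>\<^sup>2 * \<nu> \<le> 0.000025" by simp
    have "\<alpha>\<^sup>2 * 1 \<le> \<alpha>\<^sup>2 * \<nu>" using \<nu> by (intro mult_left_mono) auto
    then show "\<alpha>\<^sup>2 \<le> 0.000025" using 1 by linarith
  qed
  have \<alpha>1: "\<alpha> \<le> 0.005"
    by (rule power2_le_imp_le) (use \<alpha>2(2) in \<open>simp_all add: power2_eq_square\<close>)
  \<comment> \<open>The length is at most \<omega> = 0.005; the larger 0.006 provides the strict
    inequality that the step lemmas require.\<close>
  have step: "local_norm x (\<alpha> *\<^sub>R dx) < 0.006"
  proof -
    have "0.9596 * (local_norm x dx)\<^sup>2 \<le> q"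
      using scaling_lower_bound[OF x \<mu>, of "0.02" dx] prox by (simp add: q_def power2_eq_square)
    then have "\<alpha>\<^sup>2 * (0.9596 * (local_norm x dx)\<^sup>2) \<le> \<alpha>\<^sup>2 * (\<nu> + 0.4525)"
      using q by (intro mult_left_mono) auto
    then have "\<alpha>\<^sup>2 * (0.9596 * (local_norm x dx)\<^sup>2) \<le> 0.000025 * 0.9596"
      using \<alpha>(2) by (rule order_trans)
    then have "\<alpha>\<^sup>2 * (local_norm x dx)\<^sup>2 \<le> 0.000025" by simp
    then have "(local_norm x (\<alpha> *\<^sub>R dx))\<^sup>2 \<le> 0.005\<^sup>2"
      unfolding local_norm_scale power_mult_distrib power2_abs by (simp add: power2_eq_square[of "1/200"])
    then have "local_norm x (\<alpha> *\<^sub>R dx) \<le> 0.005" by (rule power2_le_imp_le) simp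
    then show ?thesis by simp
  qed
  \<comment> \<open>The second-order term enters <x,s> and \<kappa>\<tau> with opposite signs, since
    their sum shrinks by exactly 1 - \<alpha>.\<close>
  define Z Y where "Z = \<alpha>\<^sup>2 * \<zeta>" and "Y = Z / \<nu>"
  have Z: "\<bar>Z\<bar> \<le> 0.00000625"
  proof -
    have "\<alpha>\<^sup>2 * (- 0.25 * B) \<le> Z" "Z \<le> \<alpha>\<^sup>2 * (\<nu> / 4)"
      unfolding Z_def using \<zeta> by (intro mult_left_mono; simp)+
    moreover have "\<alpha>\<^sup>2 * B \<le> \<alpha>\<^sup>2 * 1" using B by (intro mult_left_mono) auto
    ultimately show ?thesis using \<alpha>2 by simp
  qed
  note Y1 = abs_divide_nu_le[of Z, folded Y_def]
  define k where "k = 1 - \<alpha> + Y"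
  have gap: "compl_gap \<nu> (x + \<alpha> *\<^sub>R dx) (s + \<alpha> *\<^sub>R ds) = \<mu> * k"
  proof -
    have "(x + \<alpha> *\<^sub>R dx) \<bullet> (s + \<alpha> *\<^sub>R ds) = \<nu> * \<mu> * (1 - \<alpha>) - \<alpha>\<^sup>2 * \<mu> * (q + e)"
      by (simp add: ds' inner_simps xs sdx e_def[symmetric] q_def[symmetric] algebra_simps power2_eq_square)
    also have "\<dots> = \<nu> * \<mu> * k" unfolding qe using \<nu> by (simp add: k_def Y_def Z_def field_simps)
    finally show ?thesis using \<nu> by (simp add: compl_gap_def)
  qed
  have k: "0.994 \<le> k" "k \<le> 1.001" "\<bar>k - 1\<bar> \<le> 0.006"
    unfolding k_def abs_le_iff using \<alpha>(1) \<alpha>1 Z Y1(2) by (auto simp: abs_le_iff)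
  have \<kappa>\<tau>: "(\<kappa> + \<alpha> * d\<kappa>) * (\<tau> + \<alpha> * d\<tau>) = \<mu> * ((1 - \<alpha>) * B - Z)"
  proof -
    have "(\<kappa> + \<alpha> * d\<kappa>) * (\<tau> + \<alpha> * d\<tau>) = (\<kappa> * \<tau>) * ((1 - \<alpha>) - \<alpha>\<^sup>2 * (t + t\<^sup>2))"
      by (simp add: dt algebra_simps power2_eq_square)
    then show ?thesis by (simp add: B(1) Z_def \<zeta>_def algebra_simps)
  qed
  have B': "0.9 * (1 - \<alpha>) \<le> (1 - \<alpha>) * B" "(1 - \<alpha>) * B \<le> 0.905 * (1 - \<alpha>)"
    using mult_left_mono[OF B(2), of "1 - \<alpha>"] mult_left_mono[OF B(3), of "1 - \<alpha>"] \<alpha>1 by simp_all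
  \<comment> \<open>The product formula alone leaves both signs possible. Bounding
    \<open>t + 1/2\<close> fixes the sign of the new \<tau>, and the product then gives that of
    \<kappa>.\<close>
  have "0 < 1 + \<alpha> * t"
  proof -
    have "(t + 1/2)\<^sup>2 \<le> \<nu> * 0.6"
    proof -
      have "0.9 * (t + t\<^sup>2) \<le> \<nu> / 4 \<or> t + t\<^sup>2 \<le> 0"
      proof (cases "t + t\<^sup>2 \<le> 0")
        case False
        then have "0.9 * (t + t\<^sup>2) \<le> \<zeta>" unfolding \<zeta>_def using B by (intro mult_right_mono) auto
        then show ?thesis using \<zeta>(2) by linarith
      qed simp
      then show ?thesis using \<nu> by (auto simp: power2_eq_square algebra_simps)
    qed
    then have "\<alpha>\<^sup>2 * (t + 1/2)\<^sup>2 \<le> \<alpha>\<^sup>2 * (\<nu> * 0.6)" by (intro mult_left_mono) auto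
    also have "\<dots> \<le> (1/10)\<^sup>2" using \<alpha>2(1) by (simp add: power2_eq_square)
    finally have "(\<alpha> * (t + 1/2))\<^sup>2 \<le> (1/10)\<^sup>2" by (simp only: power_mult_distrib)
    then have "\<bar>\<alpha> * (t + 1/2)\<bar> \<le> \<bar>1/10\<bar>" by (simp only: abs_le_square_iff)
    moreover have "\<alpha> * (t + 1/2) = \<alpha> * t + \<alpha> / 2" by (simp add: distrib_left)
    moreover have "\<alpha> \<le> 1" using \<alpha>1 by simp
    ultimately show ?thesis by linarith
  qed
  from mult_pos_pos[OF pos(1) this] have \<tau>': "0 < \<tau> + \<alpha> * d\<tau>"
    by (simp add: dt(1) algebra_simps)
  have "0 < (\<kappa> + \<alpha> * d\<kappa>) * (\<tau> + \<alpha> * d\<tau>)"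
    unfolding \<kappa>\<tau> using B' Z \<alpha>1 pos by (intro mult_pos_pos) auto
  then have \<kappa>': "0 < \<kappa> + \<alpha> * d\<kappa>" using \<tau>' by (rule zero_less_mult_pos2)
  have prox': "dual_local_norm F (x + \<alpha> *\<^sub>R dx) (psi F (x + \<alpha> *\<^sub>R dx) (s + \<alpha> *\<^sub>R ds) (\<mu> * k))
    \<le> 11/10 * ((1 - \<alpha>) * 0.02 * \<mu> + \<mu> * (0.02\<^sup>2 + 2 * 0.02) * 0.006 + \<bar>\<mu> * k - (1 - \<alpha>) * \<mu>\<bar> * sqrt \<nu>
        + \<bar>\<mu> * k - \<mu>\<bar> * 0.006 + \<mu> * k * (5 * 0.006\<^sup>2))"
  proof (rule proximity_after_step[OF x \<mu> _ prox step])
    show "s + \<alpha> *\<^sub>R ds = (1 - \<alpha>) *\<^sub>R psi F x s \<mu> - ((1 - \<alpha>) * \<mu>) *\<^sub>R g x - \<mu> *\<^sub>R (?W *v (\<alpha> *\<^sub>R dx))"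
      by (simp add: ds' psi_def matrix_vector_mult_scaleR algebra_simps)
  qed (use \<alpha>1 k pos in auto)
  also have "\<dots> \<le> 0.03518 * (\<mu> * k)"
  proof -
    have "\<bar>\<mu> * k - (1 - \<alpha>) * \<mu>\<bar> * sqrt \<nu> = \<mu> * (\<bar>Y\<bar> * sqrt \<nu>)"
    proof -
      have "\<mu> * k - (1 - \<alpha>) * \<mu> = \<mu> * Y" by (simp add: k_def algebra_simps)
      then show ?thesis using pos by (simp add: abs_mult)
    qed
    also have "\<dots> \<le> \<mu> * 0.00000625" using Y1 Z pos by (intro mult_left_mono) auto
    finally have 1: "\<bar>\<mu> * k - (1 - \<alpha>) * \<mu>\<bar> * sqrt \<nu> \<le> \<mu> * 0.00000625" .
    have "\<mu> * k - \<mu> = \<mu> * (k - 1)" by (simp add: right_diff_distrib)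
    then have "\<bar>\<mu> * k - \<mu>\<bar> = \<mu> * \<bar>k - 1\<bar>" using pos by (simp only: abs_mult)
    also have "\<dots> \<le> \<mu> * 0.006" using k pos by (intro mult_left_mono) auto
    finally have 2: "\<bar>\<mu> * k - \<mu>\<bar> \<le> \<mu> * 0.006" .
    have 3: "\<mu> * 0.994 \<le> \<mu> * k" "\<mu> * k \<le> \<mu> * 1.001" using k pos by simp_all
    have 4: "(1 - \<alpha>) * 0.02 * \<mu> \<le> 0.02 * \<mu>" using \<alpha> pos by simp
    obtain M L where abb: "M = \<mu> * k" "L = (1 - \<alpha>) * 0.02 * \<mu>" by blast
    show ?thesis using 1 2 3 4 pos unfolding abb[symmetric] by (simp add: power2_eq_square)
  qed
  finally have prox'': "dual_local_norm F (x + \<alpha> *\<^sub>R dx) (psi F (x + \<alpha> *\<^sub>R dx) (s + \<alpha> *\<^sub>R ds) (\<mu> * k)) \<le> 0.03518 * (\<mu> * k)" .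
  have "0.89995 * k \<le> (1 - \<alpha>) * B - Z" "(1 - \<alpha>) * B - Z \<le> 0.90503 * k"
    unfolding k_def using B' Z Y1(2) \<alpha>1 \<alpha>(1) by (auto simp: abs_le_iff)
  from this[THEN mult_left_mono, OF less_imp_le[OF pos(3)]]
  have "0.89995 * (\<mu> * k) \<le> \<mu> * ((1 - \<alpha>) * B - Z)" "\<mu> * ((1 - \<alpha>) * B - Z) \<le> 0.90503 * (\<mu> * k)"
    by (simp_all only: mult.left_commute[of _ \<mu>])
  then show ?thesis
    using prox'' dikin_ellipsoid[OF x, of "\<alpha> *\<^sub>R dx"] step \<tau>' \<kappa>' k pos
    by - (rule nbhdI, unfold gap \<kappa>\<tau>, simp_all)
qed

text \<open>The step length is not prescribed but read off from orthogonality: \<xi> is bounded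
  below by a quadratic in the local length \<open>n\<close> and above by the small centrality defect
  \<rho>, and the two together bound \<open>n\<close>.\<close>

lemma corrector_point_in_nbhd:
  fixes y' :: "real^'m"
  assumes \<mu>eq: "\<mu> = compl_gap \<nu> x s" and x: "x \<in> interior K" and pos: "0 < \<tau>" "0 < \<kappa>" "0 < \<mu>"
    and prox: "dual_local_norm F x (psi F x s \<mu>) \<le> 0.03518 * \<mu>"
    and \<beta>: "0.89995 * \<mu> \<le> \<kappa> * \<tau>" "\<kappa> * \<tau> \<le> 0.90503 * \<mu>"
    and ds: "ds + \<mu> *\<^sub>R (scaling F \<nu> x s *v dx) = - psi F x s \<mu>"
    and d\<tau>: "\<tau> * d\<kappa> + \<kappa> * d\<tau> = 0.9025 * \<mu> - \<kappa> * \<tau>"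
    and orth: "dx \<bullet> ds + d\<tau> * d\<kappa> = 0"
  shows "((x + 0.85 *\<^sub>R dx, \<tau> + 0.85 * d\<tau>), y', (s + 0.85 *\<^sub>R ds, \<kappa> + 0.85 * d\<kappa>)) \<in> nbhd K F \<nu> 0.01665 0.90028 0.90376"
proof -
  note \<mu> = \<mu>eq pos(3)
  note \<nu> = nu_ge_1
  let ?W = "scaling F \<nu> x s" and ?\<psi> = "psi F x s \<mu>"
  define t where "t = d\<tau> / \<tau>"
  define B where "B = \<kappa> * \<tau> / \<mu>"
  have B: "\<kappa> * \<tau> = B * \<mu>" "0.89995 \<le> B" "B \<le> 0.90503"
    using \<beta> pos by (simp_all add: B_def field_simps)
  define \<rho> where "\<rho> = 0.9025 - B"
  have \<rho>: "\<bar>\<rho>\<bar> \<le> 0.00255" unfolding \<rho>_def abs_le_iff using B by simp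
  have dt: "d\<tau> = \<tau> * t" "\<tau> * d\<kappa> = \<mu> * (\<rho> - B * t)"
  proof -
    show *: "d\<tau> = \<tau> * t" using pos by (simp add: t_def)
    show "\<tau> * d\<kappa> = \<mu> * (\<rho> - B * t)" 
    proof -
      have "\<kappa> * d\<tau> = (B * \<mu>) * t" by (simp add: * flip: B(1))
      then show ?thesis using d\<tau> B(1) by (simp add: \<rho>_def algebra_simps)
    qed
  qed
  have ds': "ds = - ?\<psi> - \<mu> *\<^sub>R (?W *v dx)" using ds by (simp add: algebra_simps eq_neg_iff_add_eq_0)
  define \<xi> where "\<xi> = t * (\<rho> - B * t)"
  have dd: "d\<tau> * d\<kappa> = \<mu> * \<xi>"
  proof -
    have "d\<tau> * d\<kappa> = t * (\<tau> * d\<kappa>)" by (simp add: dt(1))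
    then show ?thesis by (simp add: dt(2) \<xi>_def)
  qed
  define n q where "n = local_norm x dx" and "q = dx \<bullet> (?W *v dx)"
  have n0: "0 \<le> n" using x by (simp add: n_def)
  have \<psi>dx: "\<bar>?\<psi> \<bullet> dx\<bar> \<le> 0.03518 * \<mu> * n"
    using dual_local_norm_bound[OF x, of ?\<psi> dx] mult_right_mono[OF prox local_norm_nonneg[OF x, of dx]]
    by (simp add: n_def)
  have q: "0.9284 * n\<^sup>2 \<le> q"
  proof -
    have "0.9284 * n\<^sup>2 \<le> (1 - (0.03518\<^sup>2 + 2 * 0.03518)) * n\<^sup>2"
      by (intro mult_right_mono) (auto simp: power2_eq_square)
    then show ?thesis
      using scaling_lower_bound[OF x \<mu>, of "0.03518" dx] prox by (simp add: q_def n_def)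
  qed
  have "\<mu> * \<xi> = ?\<psi> \<bullet> dx + \<mu> * q"
    using orth unfolding dd by (simp add: ds' inner_simps q_def inner_commute[of dx] algebra_simps)
  moreover have "\<mu> * (0.9284 * n\<^sup>2) \<le> \<mu> * q" using q pos by simp
  ultimately have "\<mu> * (0.9284 * n\<^sup>2 - 0.03518 * n) \<le> \<mu> * \<xi>"
    using \<psi>dx by (simp add: algebra_simps abs_le_iff)
  then have \<xi>low: "0.9284 * n\<^sup>2 - 0.03518 * n \<le> \<xi>" using pos by simp
  have \<xi>up: "\<xi> \<le> 0.000002"
  proof -
    \<comment> \<open>Completing the square: the maximum of t (\<rho> - B t) is \<rho>^2 / (4
      B).\<close>
    have "0 \<le> (2 * B * t - \<rho>)\<^sup>2" by simp
    then have "4 * B * \<xi> \<le> \<rho>\<^sup>2" by (simp add: \<xi>_def power2_eq_square algebra_simps)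
    also have "\<dots> = \<bar>\<rho>\<bar>\<^sup>2" by simp
    also have "\<dots> \<le> 0.00255\<^sup>2" using \<rho> by (intro power_mono) auto
    finally have *: "4 * B * \<xi> \<le> 0.0000066" by (simp add: power2_eq_square)
    show ?thesis
    proof (rule ccontr)
      assume "\<not> ?thesis"
      then have "4 * 0.89995 * 0.000002 \<le> 4 * B * \<xi>" using B by (intro mult_mono) auto
      then show False using * by simp
    qed
  qed
  have \<xi>low': "- 0.00034 \<le> \<xi>"
  proof -
    \<comment> \<open>The vertex of the quadratic; 0.9284 rounds down 1 - (0.03518^2 + 2 *
      0.03518).\<close>
    have "0 \<le> 0.9284 * (n - 0.03518 / (2 * 0.9284))\<^sup>2" by simp
    then have "- 0.00034 \<le> 0.9284 * n\<^sup>2 - 0.03518 * n" by (simp add: power2_eq_square algebra_simps)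
    then show ?thesis using \<xi>low by linarith
  qed
  \<comment> \<open>At 0.0382 the quadratic already exceeds 0.00001, above the bound 0.000002 on
    \<xi>.\<close>
  have n: "n \<le> 0.0382"
  proof (rule ccontr)
    assume "\<not> ?thesis"
    then have "0.0382 * (0.9284 * 0.0382 - 0.03518) \<le> n * (0.9284 * n - 0.03518)"
      by (intro mult_mono) auto
    then have "0.00001 \<le> 0.9284 * n\<^sup>2 - 0.03518 * n" by (simp add: power2_eq_square algebra_simps)
    then show False using \<xi>low \<xi>up by simp
  qed
  have step: "local_norm x (0.85 *\<^sub>R dx) < 0.0325" using n by (simp add: local_norm_scale n_def)
  \<comment> \<open>Deliberately crude; it serves only to keep \<tau> positive after the
    step.\<close>
  have t: "\<bar>t\<bar> \<le> 1/2"
  proof (rule ccontr)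
    assume "\<not> ?thesis"
    then have t: "1/2 \<le> \<bar>t\<bar>" by simp
    have "0.4 \<le> B * \<bar>t\<bar> - \<bar>\<rho>\<bar>" using mult_mono[of "0.89995" B "1/2" "\<bar>t\<bar>"] t B \<rho> by simp
    then have "1/2 * 0.4 \<le> \<bar>t\<bar> * (B * \<bar>t\<bar> - \<bar>\<rho>\<bar>)" using t by (intro mult_mono) auto
    also have "\<dots> \<le> - \<xi>"
    proof -
      have "t * \<rho> \<le> \<bar>t\<bar> * \<bar>\<rho>\<bar>" using abs_ge_self[of "t * \<rho>"] by (simp add: abs_mult)
      then show ?thesis by (simp add: \<xi>_def algebra_simps)
    qed
    finally show False using \<xi>low' by simp
  qed
  \<comment> \<open>Orthogonality of \<psi> and \<open>x\<close> makes the first-order change of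
    <x,s> vanish, so \<mu> changes only through \<xi>.\<close>
  have \<psi>x: "?\<psi> \<bullet> x = 0" "x \<bullet> ?\<psi> = 0"
    using gradient_inner_self[OF x] \<nu> by (simp_all add: psi_def inner_simps \<mu>eq compl_gap_def inner_commute)
  have sdx: "\<mu> * (x \<bullet> (?W *v dx)) = s \<bullet> dx" by (rule inner_scaling_self(2)[OF x \<mu>])
  have xs: "x \<bullet> s = \<nu> * \<mu>" using \<nu> by (simp add: \<mu>eq compl_gap_def)
  define Z Y where "Z = 0.7225 * \<xi>" and "Y = Z / \<nu>"
  have Z: "\<bar>Z\<bar> \<le> 0.00025" "Z \<le> 0.000002" using \<xi>low' \<xi>up by (simp_all add: Z_def abs_le_iff)
  note Y1 = abs_divide_nu_le[of Z, folded Y_def]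
  define k where "k = 1 - Y"
  have gap: "compl_gap \<nu> (x + 0.85 *\<^sub>R dx) (s + 0.85 *\<^sub>R ds) = \<mu> * k"
  proof -
    have "x \<bullet> ds = - (dx \<bullet> s)" using \<psi>x sdx by (simp add: ds' inner_simps inner_commute)
    moreover have "dx \<bullet> ds = - (\<mu> * \<xi>)" using orth dd by simp
    ultimately have "(x + 0.85 *\<^sub>R dx) \<bullet> (s + 0.85 *\<^sub>R ds) = \<nu> * \<mu> - \<mu> * Z"
      by (simp add: inner_simps xs Z_def algebra_simps)
    also have "\<dots> = \<nu> * \<mu> * k" using \<nu> by (simp add: k_def Y_def field_simps)
    finally show ?thesis using \<nu> by (simp add: compl_gap_def)
  qed
  have k: "0.999 \<le> k" "k \<le> 1.001" "\<bar>k - 1\<bar> \<le> 0.00025"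
    using Z Y1(2) by (auto simp: k_def abs_le_iff)
  \<comment> \<open>0.767125 = 0.85 * 0.9025 and 0.7225 = 0.85^2.\<close>
  have \<kappa>\<tau>: "(\<kappa> + 0.85 * d\<kappa>) * (\<tau> + 0.85 * d\<tau>) = \<mu> * (0.15 * B + 0.767125 + Z)"
  proof -
    have "(\<kappa> + 0.85 * d\<kappa>) * (\<tau> + 0.85 * d\<tau>)
        = \<kappa> * \<tau> + 0.85 * (\<tau> * d\<kappa> + \<kappa> * d\<tau>) + 0.7225 * (d\<tau> * d\<kappa>)" by (simp add: algebra_simps)
    then show ?thesis unfolding d\<tau> dd B(1) by (simp add: Z_def algebra_simps)
  qed
  have "0 < \<tau> * (1 + 0.85 * t)" using t pos by (intro mult_pos_pos) (auto simp: abs_le_iff)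
  then have \<tau>': "0 < \<tau> + 0.85 * d\<tau>" by (simp add: dt(1) algebra_simps)
  have "0 < (\<kappa> + 0.85 * d\<kappa>) * (\<tau> + 0.85 * d\<tau>)"
    unfolding \<kappa>\<tau> using B Z pos by (intro mult_pos_pos) auto
  then have \<kappa>': "0 < \<kappa> + 0.85 * d\<kappa>" using \<tau>' by (rule zero_less_mult_pos2)
  have prox': "dual_local_norm F (x + 0.85 *\<^sub>R dx) (psi F (x + 0.85 *\<^sub>R dx) (s + 0.85 *\<^sub>R ds) (\<mu> * k))
    \<le> 11/10 * (0.15 * 0.03518 * \<mu> + \<mu> * (0.03518\<^sup>2 + 2 * 0.03518) * 0.0325 + \<bar>\<mu> * k - \<mu>\<bar> * sqrt \<nu>
        + \<bar>\<mu> * k - \<mu>\<bar> * 0.0325 + \<mu> * k * (5 * 0.0325\<^sup>2))"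
  proof (rule proximity_after_step[OF x \<mu> _ prox step])
    have "s = ?\<psi> - \<mu> *\<^sub>R g x" by (simp add: psi_def)
    then have "s + 0.85 *\<^sub>R ds = ?\<psi> - 0.85 *\<^sub>R ?\<psi> - \<mu> *\<^sub>R g x - 0.85 *\<^sub>R \<mu> *\<^sub>R (?W *v dx)"
      by (simp add: ds' algebra_simps)
    also have "?\<psi> - 0.85 *\<^sub>R ?\<psi> = 0.15 *\<^sub>R ?\<psi>" by (simp add: vec_eq_iff)
    finally show "s + 0.85 *\<^sub>R ds = 0.15 *\<^sub>R ?\<psi> - \<mu> *\<^sub>R g x - \<mu> *\<^sub>R (?W *v (0.85 *\<^sub>R dx))"
      by (simp add: matrix_vector_mult_scaleR mult.commute)
  qed (use k pos in auto)
  also have "\<dots> \<le> 0.01665 * (\<mu> * k)"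
  proof -
    have "\<mu> * k - \<mu> = - \<mu> * Y" by (simp add: k_def algebra_simps)
    then have eq: "\<bar>\<mu> * k - \<mu>\<bar> = \<mu> * \<bar>Y\<bar>" using pos by (simp add: abs_mult)
    have "\<bar>\<mu> * k - \<mu>\<bar> * sqrt \<nu> = \<mu> * (\<bar>Y\<bar> * sqrt \<nu>)" by (simp add: eq)
    also have "\<dots> \<le> \<mu> * 0.00025" using Y1 Z pos by (intro mult_left_mono) auto
    finally have 1: "\<bar>\<mu> * k - \<mu>\<bar> * sqrt \<nu> \<le> \<mu> * 0.00025" .
    have 2: "\<bar>\<mu> * k - \<mu>\<bar> \<le> \<mu> * 0.00025" unfolding eq using Y1 Z pos by (intro mult_left_mono) auto
    have 3: "\<mu> * 0.999 \<le> \<mu> * k" "\<mu> * k \<le> \<mu> * 1.001" using k pos by simp_all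
    obtain M where M: "M = \<mu> * k" by simp
    show ?thesis using 1 2 3 pos unfolding M[symmetric] by (simp add: power2_eq_square)
  qed
  finally have prox'': "dual_local_norm F (x + 0.85 *\<^sub>R dx) (psi F (x + 0.85 *\<^sub>R dx) (s + 0.85 *\<^sub>R ds) (\<mu> * k))
      \<le> 0.01665 * (\<mu> * k)" .
  have "0.90028 * k \<le> 0.15 * B + 0.767125 + Z" "0.15 * B + 0.767125 + Z \<le> 0.90376 * k"
    unfolding k_def using B Z Y1(2) by (auto simp: abs_le_iff)
  from this[THEN mult_left_mono, OF less_imp_le[OF pos(3)]]
  have "0.90028 * (\<mu> * k) \<le> \<mu> * (0.15 * B + 0.767125 + Z)" "\<mu> * (0.15 * B + 0.767125 + Z) \<le> 0.90376 * (\<mu> * k)"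
    by (simp_all only: mult.left_commute[of _ \<mu>])
  then show ?thesis
    using prox'' dikin_ellipsoid[OF x, of "0.85 *\<^sub>R dx"] step \<tau>' \<kappa>' k pos
    by - (rule nbhdI, unfold gap \<kappa>\<tau>, simp_all)
qed

end

theorem theorem4p14:
  fixes K :: "(real^'n) set" and F :: "real^'n \<Rightarrow> real" and \<nu> :: real
    and A :: "real^'n^'m" and b :: "real^'m" and c :: "real^'n"
    and \<eta> \<beta>\<^sub>l \<beta>\<^sub>u \<omega> \<alpha>\<^sub>c \<sigma> \<delta> \<gamma> \<alpha>\<^sub>p :: real
    and z zp zpp :: "('n, 'm) point"
  assumes K: "proper_cone K"
    and F: "lhscb K \<nu> F"
    and A: "rank A = CARD('m)"
    and params: "\<eta> = 0.02" "\<beta>\<^sub>l = 0.9" "\<beta>\<^sub>u = 0.905" "\<omega> = 0.005" "\<alpha>\<^sub>c = 0.85" "\<sigma> = 0.9025"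
    and \<delta>: "\<delta> = \<eta>\<^sup>2 + 2 * \<eta>"
    and \<gamma>: "\<gamma> = sqrt ((\<eta> + sqrt \<nu>)\<^sup>2 / (1 - \<delta>) + \<beta>\<^sub>u / 2)"
    and \<alpha>\<^sub>p: "\<alpha>\<^sub>p = \<omega> * sqrt (1 - \<delta>) / \<gamma>"
    and z: "z \<in> nbhd K F \<nu> \<eta> \<beta>\<^sub>l \<beta>\<^sub>u"
    and zp: "zp = z + \<alpha>\<^sub>p *\<^sub>R predictor_direction F \<nu> A b c z"
    and zpp: "zpp = zp + \<alpha>\<^sub>c *\<^sub>R corrector_direction F \<nu> A b c \<sigma> zp"
  shows "zp \<in> nbhd K F \<nu> 0.03518 0.89995 0.90503
    \<and> zpp \<in> nbhd K F \<nu> 0.01665 0.90028 0.90376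
    \<and> zpp \<in> nbhd K F \<nu> \<eta> \<beta>\<^sub>l \<beta>\<^sub>u"
proof -
  interpret lhscb_cone K \<nu> F by standard (fact K F)+
  have \<delta>': "1 - \<delta> = 0.9596" by (simp add: \<delta> params power2_eq_square)
  \<comment> \<open>0.4525 is half of \<beta>_u. Multiplied by the squared step length, this turns
    the definition of \<alpha>_p into the condition required by the predictor lemma.\<close>
  have \<gamma>2: "\<nu> + 0.4525 \<le> \<gamma>\<^sup>2" "0 < \<gamma>"
  proof -
    have "\<nu> = (sqrt \<nu>)\<^sup>2" using nu_pos by simp
    also have "\<dots> \<le> (\<eta> + sqrt \<nu>)\<^sup>2" using nu_pos by (intro power_mono) (auto simp: params)
    also have "\<dots> \<le> (\<eta> + sqrt \<nu>)\<^sup>2 / (1 - \<delta>)" by (simp add: \<delta>' field_simps)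
    finally have *: "\<nu> + 0.4525 \<le> (\<eta> + sqrt \<nu>)\<^sup>2 / (1 - \<delta>) + \<beta>\<^sub>u / 2" by (simp add: params)
    then show "\<nu> + 0.4525 \<le> \<gamma>\<^sup>2" using nu_pos by (simp add: \<gamma>)
    show "0 < \<gamma>" unfolding \<gamma> by (rule real_sqrt_gt_zero, rule less_le_trans[OF _ *]) (use nu_pos in simp)
  qed
  have \<alpha>: "0 < \<alpha>\<^sub>p" "\<alpha>\<^sub>p\<^sup>2 * (\<nu> + 0.4525) \<le> 0.000025 * 0.9596"
  proof -
    show "0 < \<alpha>\<^sub>p" using \<gamma>2(2) by (simp add: \<alpha>\<^sub>p \<delta>' params)
    have "\<alpha>\<^sub>p\<^sup>2 * (\<nu> + 0.4525) \<le> \<alpha>\<^sub>p\<^sup>2 * \<gamma>\<^sup>2" using \<gamma>2(1) by (intro mult_left_mono) auto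
    also have "\<dots> = (\<omega> * sqrt (1 - \<delta>))\<^sup>2" using \<gamma>2(2) by (simp add: \<alpha>\<^sub>p flip: power_mult_distrib)
    also have "\<dots> = 0.000025 * 0.9596" unfolding \<delta>' power_mult_distrib by (simp add: params power2_eq_square)
    finally show "\<alpha>\<^sub>p\<^sup>2 * (\<nu> + 0.4525) \<le> 0.000025 * 0.9596" .
  qed
  obtain x \<tau> y s \<kappa> where z_eq: "z = ((x, \<tau>), y, (s, \<kappa>))" by (metis prod.exhaust)
  note Z = nbhdD[OF z[unfolded z_eq params]]
  obtain dx d\<tau> dy ds d\<kappa> where dz: "predictor_direction F \<nu> A b c z = ((dx, d\<tau>), dy, (ds, d\<kappa>))"
    by (metis prod.exhaust)
  have "predictor_system F \<nu> A b c ((x, \<tau>), y, (s, \<kappa>)) ((dx, d\<tau>), dy, (ds, d\<kappa>))"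
    unfolding dz[symmetric] unfolding z_eq
    by (rule predictor_directionI, rule bij_newton_map_scaling[of _ _ _ _ _ "0.02"])
       (use A Z in \<open>auto simp: power2_eq_square\<close>)
  note psys = this predictor_system_orthogonal[OF this]
  have zp_in: "zp \<in> nbhd K F \<nu> 0.03518 0.89995 0.90503"
  proof -
    have "zp = ((x + \<alpha>\<^sub>p *\<^sub>R dx, \<tau> + \<alpha>\<^sub>p * d\<tau>), y + \<alpha>\<^sub>p *\<^sub>R dy, (s + \<alpha>\<^sub>p *\<^sub>R ds, \<kappa> + \<alpha>\<^sub>p * d\<kappa>))"
      unfolding zp dz by (simp add: z_eq)
    moreover have "\<dots> \<in> nbhd K F \<nu> 0.03518 0.89995 0.90503"
      by (rule predictor_point_in_nbhd[OF refl]) (use Z \<alpha> psys in \<open>auto simp: predictor_system_def\<close>)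
    ultimately show ?thesis by simp
  qed
  obtain x \<tau> y s \<kappa> where zp_eq: "zp = ((x, \<tau>), y, (s, \<kappa>))" by (metis prod.exhaust)
  note Z = nbhdD[OF zp_in[unfolded zp_eq]]
  obtain dx d\<tau> dy ds d\<kappa> where dz: "corrector_direction F \<nu> A b c \<sigma> zp = ((dx, d\<tau>), dy, (ds, d\<kappa>))"
    by (metis prod.exhaust)
  have "corrector_system F \<nu> A b c \<sigma> ((x, \<tau>), y, (s, \<kappa>)) ((dx, d\<tau>), dy, (ds, d\<kappa>))"
    unfolding dz[symmetric] unfolding zp_eq
    by (rule corrector_directionI, rule bij_newton_map_scaling[of _ _ _ _ _ "0.03518"])
       (use A Z in \<open>auto simp: power2_eq_square\<close>)
  note csys = this corrector_system_orthogonal[OF this]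
  have zpp_in: "zpp \<in> nbhd K F \<nu> 0.01665 0.90028 0.90376"
  proof -
    have "zpp = ((x + 0.85 *\<^sub>R dx, \<tau> + 0.85 * d\<tau>), y + 0.85 *\<^sub>R dy, (s + 0.85 *\<^sub>R ds, \<kappa> + 0.85 * d\<kappa>))"
      unfolding zpp dz by (simp add: zp_eq params)
    moreover have "\<dots> \<in> nbhd K F \<nu> 0.01665 0.90028 0.90376"
      by (rule corrector_point_in_nbhd[OF refl]) (use Z csys params in \<open>auto simp: corrector_system_def\<close>)
    ultimately show ?thesis by simp
  qed
  have "zpp \<in> nbhd K F \<nu> \<eta> \<beta>\<^sub>l \<beta>\<^sub>u"
  proof -
    obtain x \<tau> y s \<kappa> where zpp_eq: "zpp = ((x, \<tau>), y, (s, \<kappa>))" by (metis prod.exhaust)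
    note Z = nbhdD[OF zpp_in[unfolded zpp_eq]]
    show ?thesis unfolding zpp_eq params by (rule nbhdI) (use Z in auto)
  qed
  with zp_in zpp_in show ?thesis by blast
qed

end
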